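(* Let $G\rightrightarrows G_0$ and $H\rightrightarrows H_0$ be diffeological groupoids and let $X$ be a diffeological $(G,H)$-bibundle. Then $X$ is weakly invertible if and only if $X$ is biprincipal. In other words, two diffeological groupoids are Morita equivalent if and only if there exists a weakly invertible diffeological bibundle between them.
   Context: Diffeology. A Euclidean domain is an open subset of some $\mathbb{R}^m$, $m\geq 0$. A diffeology on a set $X$ is a set of functions from Euclidean domains to $X$, called plots, such that: all constant functions are plots; if $\alpha:U\to X$ is a plot and $h:V\to U$ is a smooth map between Euclidean domains, then $\alpha\circ h$ is a plot; a function $\alpha:U\to X$ whose restriction to each member of some open cover of $U$ is a plot is itself a plot. A diffeological space is a set with a diffeology. A function $f$ between diffeological spaces is smooth if $f\circ\alpha$ is a plot for every plot $\alpha$; a diffeomorphism is a smooth bijection with smooth inverse. The plots of a product are the functions whose two components are plots; the plots of a subset are the functions into it that are plots of the ambient space; the fibred product $X\times_Z^{f,g}Y=\{(x,y)\in X\times Y: f(x)=g(y)\}$ has the subset diffeology of the product. The plots of a quotient $X/{\sim}$ are the functions that locally lift along the projection to plots of $X$. A subduction is a smooth surjection $f:X\to Y$ such that for every plot $\alpha:U\to Y$ and $t\in U$ there are an open neighbourhood $V\subseteq U$ of $t$ and a plot $\beta:V\to X$ with $\alpha|_V=f\circ\beta$. Diffeological groupoids. A diffeological groupoid $G\rightrightarrows G_0$ is a groupoid whose object set $G_0$ and arrow set $G$ are diffeological spaces such that source $\mathrm{src}$, target $\mathrm{trg}$, unit $x\mapsto \mathrm{id}_x$, inversion and composition $G\times_{G_0}^{\mathrm{src},\mathrm{trg}}G\to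 G$, $(g,h)\mapsto g\circ h$, are smooth. Actions. A smooth left action of $G$ on a diffeological space $X$ along a smooth map $l_X:X\to G_0$ (left moment map) is a smooth map $G\times_{G_0}^{\mathrm{src},l_X}X\to X$, $(g,x)\mapsto gx$, with $l_X(gx)=\mathrm{trg}(g)$, $\mathrm{id}_{l_X(x)}x=x$ and $h(gx)=(h\circ g)x$ whenever defined. A smooth right action of $H$ on $X$ along $r_X:X\to H_0$ (right moment map) is a smooth map $X\times_{H_0}^{r_X,\mathrm{trg}}H\to X$, $(x,h)\mapsto xh$, with $r_X(xh)=\mathrm{src}(h)$, $x\,\mathrm{id}_{r_X(x)}=x$ and $(xh)h'=x(h\circ h')$ whenever defined. Bibundles. A diffeological $(G,H)$-bibundle is a diffeological space $X$ with a smooth left $G$-action along $l_X$ and a smooth right $H$-action along $r_X$ such that $l_X(xh)=l_X(x)$, $r_X(gx)=r_X(x)$ and $(gx)h=g(xh)$ whenever defined. It is left subductive if $r_X:X\to H_0$ is a subduction, and left pre-principal if $G\times_{G_0}^{\mathrm{src},l_X}X\to X\times_{H_0}^{r_X,r_X}X$, $(g,x)\mapsto(gx,x)$, is a diffeomorphism; it is right subductive if $l_X:X\to G_0$ is a subduction, and right pre-principal if $X\times_{H_0}^{r_X,\mathrm{trg}}H\to X\times_{G_0}^{l_X,l_X}X$, $(x,h)\mapsto(x,xh)$, is a diffeomorphism. Left (right) principal means left (right) subductive and left (right) pre-principal; biprincipal means left and right principal. $G$ and $H$ are Morita equivalent if a biprincipal $(G,H)$-bibundle exists. A smooth map $\varphi:X\to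 Y$ between $(G,H)$-bibundles is biequivariant if $l_Y\circ\varphi=l_X$, $r_Y\circ\varphi=r_X$, $\varphi(gx)=g\varphi(x)$ and $\varphi(xh)=\varphi(x)h$ whenever defined. Balanced tensor product. For a $(G,H)$-bibundle $X$ and an $(H,K)$-bibundle $Y$, $X\otimes_H Y$ is the quotient (with quotient diffeology) of $X\times_{H_0}^{r_X,l_Y}Y$ by the relation $(x,y)\sim(xh,h^{-1}y)$; the class of $(x,y)$ is $x\otimes y$. It is a $(G,K)$-bibundle with moment maps $x\otimes y\mapsto l_X(x)$ and $x\otimes y\mapsto r_Y(y)$ and actions $g(x\otimes y)=gx\otimes y$, $(x\otimes y)k=x\otimes yk$. The identity bibundle of $G$ is the arrow space $G$ with left moment map $\mathrm{trg}$, right moment map $\mathrm{src}$, and both actions given by composition. Weak invertibility. A $(G,H)$-bibundle $X$ is weakly invertible if there is an $(H,G)$-bibundle $Y$ (a weak inverse) such that there are biequivariant diffeomorphisms from $X\otimes_H Y$ to the identity bibundle of $G$ and from $Y\otimes_G X$ to the identity bibundle of $H$. (This is equivalence in the bicategory of diffeological groupoids, bibundles with composition given by the balanced tensor product, and biequivariant smooth maps.) *)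

theory Defs
  imports "HOL-Analysis.Analysis"
begin

section \<open>Smooth maps between Euclidean domains\<close>

text \<open>
  The dimension of a Euclidean domain varies inside the definition of a diffeology, so
  \<open>\<real>\<^sup>m\<close> is the library's \<^const>\<open>Euclidean_space\<close>: the real sequences vanishing from index \<open>m\<close> on.
\<close>

type_synonym rseq = "nat \<Rightarrow> real"

abbreviation euclidean_domain :: "nat \<Rightarrow> rseq set \<Rightarrow> bool" where
  "euclidean_domain m U \<equiv> openin (Euclidean_space m) U"

text \<open>
  \<open>C\<^sup>k\<close> by iterated continuous partial derivatives: \<open>f' x\<close> below is the \<open>i\<close>-th partial derivative
  of \<open>f\<close> at \<open>x\<close>.
\<close>

primrec Ck_on :: "nat \<Rightarrow> nat \<Rightarrow> rseq set \<Rightarrow> (rseq \<Rightarrow> real) \<Rightarrow> bool" where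
  "Ck_on 0 m U f \<longleftrightarrow> continuous_map (subtopology (Euclidean_space m) U) euclideanreal f"
| "Ck_on (Suc k) m U f \<longleftrightarrow>
     continuous_map (subtopology (Euclidean_space m) U) euclideanreal f \<and>
     (\<forall>i<m. \<exists>f'. (\<forall>x\<in>U. ((\<lambda>t. f (x(i := t))) has_real_derivative f' x) (at (x i))) \<and>
                 Ck_on k m U f')"

definition smooth_map :: "nat \<Rightarrow> rseq set \<Rightarrow> nat \<Rightarrow> rseq set \<Rightarrow> (rseq \<Rightarrow> rseq) \<Rightarrow> bool" where
  "smooth_map n V m U h \<longleftrightarrow>
     euclidean_domain n V \<and> euclidean_domain m U \<and> h ` V \<subseteq> U \<and>
     (\<forall>j<m. \<forall>k. Ck_on k n V (\<lambda>x. h x j))"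


section \<open>Diffeological spaces\<close>

text \<open>
  \<open>plot X m U \<alpha>\<close> says that the restriction of \<open>\<alpha>\<close> to \<open>U \<subseteq> \<real>\<^sup>m\<close> is a plot of \<open>X\<close>. As HOL functions
  are total, only the values of \<open>\<alpha>\<close> on \<open>U\<close> are meaningful; this is the second clause of
  \<open>diffeological_space\<close>. The same convention is used for all functions on carriers.
\<close>

record 'a dspace =
  pts :: "'a set"
  plot :: "nat \<Rightarrow> rseq set \<Rightarrow> (rseq \<Rightarrow> 'a) \<Rightarrow> bool"

definition diffeological_space :: "'a dspace \<Rightarrow> bool" where
  "diffeological_space X \<longleftrightarrow>
     (\<forall>m U \<alpha>. plot X m U \<alpha> \<longrightarrow> euclidean_domain m U \<and> \<alpha> ` U \<subseteq> pts X) \<and>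
     (\<forall>m U \<alpha> \<beta>. plot X m U \<alpha> \<longrightarrow> (\<forall>t\<in>U. \<beta> t = \<alpha> t) \<longrightarrow> plot X m U \<beta>) \<and>
     (\<forall>m U x. euclidean_domain m U \<longrightarrow> x \<in> pts X \<longrightarrow> plot X m U (\<lambda>_. x)) \<and>
     (\<forall>m U \<alpha> n V h. plot X m U \<alpha> \<longrightarrow> smooth_map n V m U h \<longrightarrow> plot X n V (\<alpha> \<circ> h)) \<and>
     (\<forall>m U \<alpha> \<V>. euclidean_domain m U \<longrightarrow> \<Union>\<V> = U \<longrightarrow>
        (\<forall>V\<in>\<V>. euclidean_domain m V \<and> plot X m V \<alpha>) \<longrightarrow> plot X m U \<alpha>)"

definition dsmooth :: "'a dspace \<Rightarrow> 'b dspace \<Rightarrow> ('a \<Rightarrow> 'b) \<Rightarrow> bool" where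
  "dsmooth X Y f \<longleftrightarrow>
     f ` pts X \<subseteq> pts Y \<and> (\<forall>m U \<alpha>. plot X m U \<alpha> \<longrightarrow> plot Y m U (f \<circ> \<alpha>))"

definition diffeomorphism :: "'a dspace \<Rightarrow> 'b dspace \<Rightarrow> ('a \<Rightarrow> 'b) \<Rightarrow> bool" where
  "diffeomorphism X Y f \<longleftrightarrow>
     dsmooth X Y f \<and> bij_betw f (pts X) (pts Y) \<and> dsmooth Y X (inv_into (pts X) f)"

definition prod_space :: "'a dspace \<Rightarrow> 'b dspace \<Rightarrow> ('a \<times> 'b) dspace" where
  "prod_space X Y =
     \<lparr> pts = pts X \<times> pts Y,
       plot = (\<lambda>m U \<alpha>. plot X m U (fst \<circ> \<alpha>) \<and> plot Y m U (snd \<circ> \<alpha>)) \<rparr>"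

definition sub_space :: "'a dspace \<Rightarrow> 'a set \<Rightarrow> 'a dspace" where
  "sub_space X S =
     \<lparr> pts = S, plot = (\<lambda>m U \<alpha>. \<alpha> ` U \<subseteq> S \<and> plot X m U \<alpha>) \<rparr>"

definition fib_prod :: "'a dspace \<Rightarrow> 'b dspace \<Rightarrow> ('a \<Rightarrow> 'c) \<Rightarrow> ('b \<Rightarrow> 'c) \<Rightarrow> ('a \<times> 'b) dspace" where
  "fib_prod X Y f g =
     sub_space (prod_space X Y) {(x, y). x \<in> pts X \<and> y \<in> pts Y \<and> f x = g y}"

definition quot_space :: "'a dspace \<Rightarrow> ('a \<times> 'a) set \<Rightarrow> 'a set dspace" where
  "quot_space X r =
     \<lparr> pts = pts X // r,
       plot = (\<lambda>m U \<alpha>. euclidean_domain m U \<and> \<alpha> ` U \<subseteq> pts X // r \<and>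
         (\<forall>t\<in>U. \<exists>V \<beta>. euclidean_domain m V \<and> t \<in> V \<and> V \<subseteq> U \<and> plot X m V \<beta> \<and>
            (\<forall>s\<in>V. \<alpha> s = r `` {\<beta> s}))) \<rparr>"

definition subduction :: "'a dspace \<Rightarrow> 'b dspace \<Rightarrow> ('a \<Rightarrow> 'b) \<Rightarrow> bool" where
  "subduction X Y f \<longleftrightarrow>
     dsmooth X Y f \<and> f ` pts X = pts Y \<and>
     (\<forall>m U \<alpha>. plot Y m U \<alpha> \<longrightarrow>
        (\<forall>t\<in>U. \<exists>V \<beta>. euclidean_domain m V \<and> t \<in> V \<and> V \<subseteq> U \<and> plot X m V \<beta> \<and>
           (\<forall>s\<in>V. \<alpha> s = f (\<beta> s))))"


section \<open>Diffeological groupoids\<close>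

record ('o, 'a) dgroupoid =
  obj :: "'o dspace"
  arr :: "'a dspace"
  src :: "'a \<Rightarrow> 'o"
  trg :: "'a \<Rightarrow> 'o"
  ident :: "'o \<Rightarrow> 'a"
  ginv :: "'a \<Rightarrow> 'a"
  gcomp :: "'a \<Rightarrow> 'a \<Rightarrow> 'a"  \<comment> \<open>\<open>gcomp G g h\<close> is \<open>g \<circ> h\<close>, defined if \<open>src g = trg h\<close>\<close>

definition groupoid :: "('o, 'a) dgroupoid \<Rightarrow> bool" where
  "groupoid G \<longleftrightarrow>
     (\<forall>g\<in>pts (arr G). src G g \<in> pts (obj G) \<and> trg G g \<in> pts (obj G)) \<and>
     (\<forall>x\<in>pts (obj G). ident G x \<in> pts (arr G) \<and>
        src G (ident G x) = x \<and> trg G (ident G x) = x) \<and>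
     (\<forall>g\<in>pts (arr G). \<forall>h\<in>pts (arr G). src G g = trg G h \<longrightarrow>
        gcomp G g h \<in> pts (arr G) \<and>
        src G (gcomp G g h) = src G h \<and> trg G (gcomp G g h) = trg G g) \<and>
     (\<forall>f\<in>pts (arr G). \<forall>g\<in>pts (arr G). \<forall>h\<in>pts (arr G). src G f = trg G g \<longrightarrow> src G g = trg G h \<longrightarrow>
        gcomp G (gcomp G f g) h = gcomp G f (gcomp G g h)) \<and>
     (\<forall>g\<in>pts (arr G). gcomp G g (ident G (src G g)) = g \<and> gcomp G (ident G (trg G g)) g = g) \<and>
     (\<forall>g\<in>pts (arr G). ginv G g \<in> pts (arr G) \<and>
        src G (ginv G g) = trg G g \<and> trg G (ginv G g) = src G g \<and>
        gcomp G (ginv G g) g = ident G (src G g) \<and> gcomp G g (ginv G g) = ident G (trg G g))"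

definition diffeological_groupoid :: "('o, 'a) dgroupoid \<Rightarrow> bool" where
  "diffeological_groupoid G \<longleftrightarrow>
     groupoid G \<and> diffeological_space (obj G) \<and> diffeological_space (arr G) \<and>
     dsmooth (arr G) (obj G) (src G) \<and> dsmooth (arr G) (obj G) (trg G) \<and>
     dsmooth (obj G) (arr G) (ident G) \<and> dsmooth (arr G) (arr G) (ginv G) \<and>
     dsmooth (fib_prod (arr G) (arr G) (src G) (trg G)) (arr G) (\<lambda>(g, h). gcomp G g h)"


section \<open>Actions and bibundles\<close>

definition smooth_left_action ::
  "('o, 'a) dgroupoid \<Rightarrow> 'x dspace \<Rightarrow> ('x \<Rightarrow> 'o) \<Rightarrow> ('a \<Rightarrow> 'x \<Rightarrow> 'x) \<Rightarrow> bool" where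
  "smooth_left_action G X l act \<longleftrightarrow>
     dsmooth X (obj G) l \<and>
     dsmooth (fib_prod (arr G) X (src G) l) X (\<lambda>(g, x). act g x) \<and>
     (\<forall>g\<in>pts (arr G). \<forall>x\<in>pts X. src G g = l x \<longrightarrow> l (act g x) = trg G g) \<and>
     (\<forall>x\<in>pts X. act (ident G (l x)) x = x) \<and>
     (\<forall>g\<in>pts (arr G). \<forall>h\<in>pts (arr G). \<forall>x\<in>pts X. src G g = l x \<longrightarrow> src G h = trg G g \<longrightarrow>
        act h (act g x) = act (gcomp G h g) x)"

definition smooth_right_action ::
  "('o, 'a) dgroupoid \<Rightarrow> 'x dspace \<Rightarrow> ('x \<Rightarrow> 'o) \<Rightarrow> ('x \<Rightarrow> 'a \<Rightarrow> 'x) \<Rightarrow> bool" where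
  "smooth_right_action H X r act \<longleftrightarrow>
     dsmooth X (obj H) r \<and>
     dsmooth (fib_prod X (arr H) r (trg H)) X (\<lambda>(x, h). act x h) \<and>
     (\<forall>x\<in>pts X. \<forall>h\<in>pts (arr H). r x = trg H h \<longrightarrow> r (act x h) = src H h) \<and>
     (\<forall>x\<in>pts X. act x (ident H (r x)) = x) \<and>
     (\<forall>x\<in>pts X. \<forall>h\<in>pts (arr H). \<forall>h'\<in>pts (arr H). r x = trg H h \<longrightarrow> src H h = trg H h' \<longrightarrow>
        act (act x h) h' = act x (gcomp H h h'))"

record ('g0, 'g, 'h0, 'h, 'x) bibundle =
  space :: "'x dspace"
  lmom :: "'x \<Rightarrow> 'g0"
  rmom :: "'x \<Rightarrow> 'h0"
  lact :: "'g \<Rightarrow> 'x \<Rightarrow> 'x"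
  ract :: "'x \<Rightarrow> 'h \<Rightarrow> 'x"

definition diffeological_bibundle ::
  "('g0, 'g) dgroupoid \<Rightarrow> ('h0, 'h) dgroupoid \<Rightarrow> ('g0, 'g, 'h0, 'h, 'x) bibundle \<Rightarrow> bool" where
  "diffeological_bibundle G H X \<longleftrightarrow>
     diffeological_space (space X) \<and>
     smooth_left_action G (space X) (lmom X) (lact X) \<and>
     smooth_right_action H (space X) (rmom X) (ract X) \<and>
     (\<forall>x\<in>pts (space X). \<forall>h\<in>pts (arr H). rmom X x = trg H h \<longrightarrow> lmom X (ract X x h) = lmom X x) \<and>
     (\<forall>g\<in>pts (arr G). \<forall>x\<in>pts (space X). src G g = lmom X x \<longrightarrow> rmom X (lact X g x) = rmom X x) \<and>
     (\<forall>g\<in>pts (arr G). \<forall>x\<in>pts (space X). \<forall>h\<in>pts (arr H).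
        src G g = lmom X x \<longrightarrow> rmom X x = trg H h \<longrightarrow>
        ract X (lact X g x) h = lact X g (ract X x h))"

definition left_subductive ::
  "('g0, 'g) dgroupoid \<Rightarrow> ('h0, 'h) dgroupoid \<Rightarrow> ('g0, 'g, 'h0, 'h, 'x) bibundle \<Rightarrow> bool" where
  "left_subductive G H X \<longleftrightarrow> subduction (space X) (obj H) (rmom X)"

definition right_subductive ::
  "('g0, 'g) dgroupoid \<Rightarrow> ('h0, 'h) dgroupoid \<Rightarrow> ('g0, 'g, 'h0, 'h, 'x) bibundle \<Rightarrow> bool" where
  "right_subductive G H X \<longleftrightarrow> subduction (space X) (obj G) (lmom X)"

definition left_pre_principal ::
  "('g0, 'g) dgroupoid \<Rightarrow> ('h0, 'h) dgroupoid \<Rightarrow> ('g0, 'g, 'h0, 'h, 'x) bibundle \<Rightarrow> bool" where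
  "left_pre_principal G H X \<longleftrightarrow>
     diffeomorphism (fib_prod (arr G) (space X) (src G) (lmom X))
       (fib_prod (space X) (space X) (rmom X) (rmom X)) (\<lambda>(g, x). (lact X g x, x))"

definition right_pre_principal ::
  "('g0, 'g) dgroupoid \<Rightarrow> ('h0, 'h) dgroupoid \<Rightarrow> ('g0, 'g, 'h0, 'h, 'x) bibundle \<Rightarrow> bool" where
  "right_pre_principal G H X \<longleftrightarrow>
     diffeomorphism (fib_prod (space X) (arr H) (rmom X) (trg H))
       (fib_prod (space X) (space X) (lmom X) (lmom X)) (\<lambda>(x, h). (x, ract X x h))"

definition left_principal ::
  "('g0, 'g) dgroupoid \<Rightarrow> ('h0, 'h) dgroupoid \<Rightarrow> ('g0, 'g, 'h0, 'h, 'x) bibundle \<Rightarrow> bool" where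
  "left_principal G H X \<longleftrightarrow> left_subductive G H X \<and> left_pre_principal G H X"

definition right_principal ::
  "('g0, 'g) dgroupoid \<Rightarrow> ('h0, 'h) dgroupoid \<Rightarrow> ('g0, 'g, 'h0, 'h, 'x) bibundle \<Rightarrow> bool" where
  "right_principal G H X \<longleftrightarrow> right_subductive G H X \<and> right_pre_principal G H X"

definition biprincipal ::
  "('g0, 'g) dgroupoid \<Rightarrow> ('h0, 'h) dgroupoid \<Rightarrow> ('g0, 'g, 'h0, 'h, 'x) bibundle \<Rightarrow> bool" where
  "biprincipal G H X \<longleftrightarrow> left_principal G H X \<and> right_principal G H X"

definition biequivariant ::
  "('g0, 'g) dgroupoid \<Rightarrow> ('h0, 'h) dgroupoid \<Rightarrow> ('g0, 'g, 'h0, 'h, 'x) bibundle \<Rightarrow>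
   ('g0, 'g, 'h0, 'h, 'y) bibundle \<Rightarrow> ('x \<Rightarrow> 'y) \<Rightarrow> bool" where
  "biequivariant G H X Y \<phi> \<longleftrightarrow>
     dsmooth (space X) (space Y) \<phi> \<and>
     (\<forall>x\<in>pts (space X). lmom Y (\<phi> x) = lmom X x \<and> rmom Y (\<phi> x) = rmom X x) \<and>
     (\<forall>g\<in>pts (arr G). \<forall>x\<in>pts (space X). src G g = lmom X x \<longrightarrow> \<phi> (lact X g x) = lact Y g (\<phi> x)) \<and>
     (\<forall>x\<in>pts (space X). \<forall>h\<in>pts (arr H). rmom X x = trg H h \<longrightarrow> \<phi> (ract X x h) = ract Y (\<phi> x) h)"


section \<open>Balanced tensor product and identity bibundle\<close>

definition balanced_rel ::
  "('h0, 'h) dgroupoid \<Rightarrow> ('g0, 'g, 'h0, 'h, 'x) bibundle \<Rightarrow> ('h0, 'h, 'k0, 'k, 'y) bibundle \<Rightarrow>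
   (('x \<times> 'y) \<times> ('x \<times> 'y)) set" where
  "balanced_rel H X Y =
     {((x, y), (ract X x h, lact Y (ginv H h) y)) | x y h.
        x \<in> pts (space X) \<and> y \<in> pts (space Y) \<and> rmom X x = lmom Y y \<and>
        h \<in> pts (arr H) \<and> trg H h = rmom X x}"

text \<open>
  The moment maps and actions are defined on classes \<open>c\<close> through their representatives;
  \<^const>\<open>the_elem\<close> picks the unique value, which does not depend on the representative.
\<close>

definition tensor ::
  "('h0, 'h) dgroupoid \<Rightarrow> ('g0, 'g, 'h0, 'h, 'x) bibundle \<Rightarrow> ('h0, 'h, 'k0, 'k, 'y) bibundle \<Rightarrow>
   ('g0, 'g, 'k0, 'k, ('x \<times> 'y) set) bibundle" where
  "tensor H X Y =
     \<lparr> space = quot_space (fib_prod (space X) (space Y) (rmom X) (lmom Y)) (balanced_rel H X Y),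
       lmom = (\<lambda>c. the_elem ((\<lambda>(x, y). lmom X x) ` c)),
       rmom = (\<lambda>c. the_elem ((\<lambda>(x, y). rmom Y y) ` c)),
       lact = (\<lambda>g c. the_elem ((\<lambda>(x, y). balanced_rel H X Y `` {(lact X g x, y)}) ` c)),
       ract = (\<lambda>c k. the_elem ((\<lambda>(x, y). balanced_rel H X Y `` {(x, ract Y y k)}) ` c)) \<rparr>"

definition id_bibundle :: "('g0, 'g) dgroupoid \<Rightarrow> ('g0, 'g, 'g0, 'g, 'g) bibundle" where
  "id_bibundle G =
     \<lparr> space = arr G, lmom = trg G, rmom = src G, lact = gcomp G, ract = gcomp G \<rparr>"


section \<open>Weak invertibility and Morita equivalence\<close>

definition weak_inverse ::
  "('g0, 'g) dgroupoid \<Rightarrow> ('h0, 'h) dgroupoid \<Rightarrow> ('g0, 'g, 'h0, 'h, 'x) bibundle \<Rightarrow>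
   ('h0, 'h, 'g0, 'g, 'y) bibundle \<Rightarrow> bool" where
  "weak_inverse G H X Y \<longleftrightarrow>
     diffeological_bibundle H G Y \<and>
     (\<exists>\<phi>. biequivariant G G (tensor H X Y) (id_bibundle G) \<phi> \<and>
          diffeomorphism (space (tensor H X Y)) (space (id_bibundle G)) \<phi>) \<and>
     (\<exists>\<psi>. biequivariant H H (tensor G Y X) (id_bibundle H) \<psi> \<and>
          diffeomorphism (space (tensor G Y X)) (space (id_bibundle H)) \<psi>)"

text \<open>
  HOL cannot quantify existentially over types, so the type hosting the points of the
  existentially quantified bibundle is an explicit parameter.
\<close>

definition weakly_invertible ::
  "'y itself \<Rightarrow> ('g0, 'g) dgroupoid \<Rightarrow> ('h0, 'h) dgroupoid \<Rightarrow>
   ('g0, 'g, 'h0, 'h, 'x) bibundle \<Rightarrow> bool" where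
  "weakly_invertible (_ :: 'y itself) G H X \<longleftrightarrow>
     (\<exists>Y :: ('h0, 'h, 'g0, 'g, 'y) bibundle. weak_inverse G H X Y)"

definition morita_equivalent ::
  "'x itself \<Rightarrow> ('g0, 'g) dgroupoid \<Rightarrow> ('h0, 'h) dgroupoid \<Rightarrow> bool" where
  "morita_equivalent (_ :: 'x itself) G H \<longleftrightarrow>
     (\<exists>X :: ('g0, 'g, 'h0, 'h, 'x) bibundle. diffeological_bibundle G H X \<and> biprincipal G H X)"

end

theory Submission
  imports Defs
begin

text \<open>
  The proof replaces a biequivariant diffeomorphism \<open>X \<otimes>\<^sub>H Y \<cong> G\<close> by the function
  \<open>p (x, y) = \<phi> (x \<otimes> y)\<close> on composable pairs. Such a function is equivariant on both sides, it is
  a subduction onto the arrows, and its fibres are exactly the orbits of \<open>H\<close>; conversely, these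
  properties say that \<open>p\<close> descends to an isomorphism on the tensor product
  (\<open>perfect_pairing_if_tensor_iso\<close>, \<open>perfect_pairing.tensor_iso\<close>). A weak inverse \<open>Y\<close> of \<open>X\<close> is
  therefore a pair of perfect pairings \<open>p : X \<times> Y \<rightarrow> G\<close> and \<open>q : Y \<times> X \<rightarrow> H\<close>, with no coherence
  between them.

  Suppose that \<open>p\<close> and \<open>q\<close> are given. Lifting units \<open>id\<^sub>a\<close> along \<open>p\<close> and \<open>q\<close> shows that all four moment
  maps are subductions. If \<open>r x = r x'\<close>, choose \<open>y\<close> with \<open>l y = r x\<close> and put
  \<open>g = p (x, y) \<circ> p (x', y)\<^sup>-\<^sup>1\<close>. Then \<open>p (g x', y) = p (x, y)\<close>, so some \<open>h\<close> carries \<open>(g x', y)\<close> to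
  \<open>(x, y)\<close>; this \<open>h\<close> fixes \<open>y\<close>, and \<open>H\<close> acts freely on \<open>Y\<close> by equivariance of \<open>q\<close>, so \<open>h\<close> is a unit
  and \<open>g x' = x\<close>. Since \<open>y\<close> can be chosen smoothly on small domains, \<open>g\<close> depends smoothly on
  \<open>(x, x')\<close>, and \<open>X\<close> is left principal (\<open>left_principal_if_perfect_pairings\<close>).

  Conversely, if \<open>X\<close> is biprincipal, the division map sending \<open>(x, y)\<close> to the arrow \<open>g\<close> with
  \<open>g y = x\<close> is a perfect pairing of \<open>X\<close> with the opposite bibundle, in which both groupoids act
  through inverses (\<open>perfect_pairing_opposite\<close>). Hence the opposite of \<open>X\<close> is a weak inverse.

  Passing to opposites exchanges left and right throughout, so only left principality has to be
  treated (\<open>biprincipal_iff_opposite\<close>, \<open>perfect_pairing.dual\<close>).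
\<close>

section \<open>Plots and smooth maps\<close>

lemma plot_domain:
  assumes "diffeological_space X" "plot X m U \<alpha>"
  shows "euclidean_domain m U"
  using assms(1)[unfolded diffeological_space_def, THEN conjunct1] assms(2) by blast

lemma plot_in_pts:
  assumes "diffeological_space X" "plot X m U \<alpha>" "t \<in> U"
  shows "\<alpha> t \<in> pts X"
  using assms(1)[unfolded diffeological_space_def, THEN conjunct1] assms(2,3) by blast

lemma plot_cong:
  assumes "diffeological_space X" "plot X m U \<alpha>" "\<And>t. t \<in> U \<Longrightarrow> \<beta> t = \<alpha> t"
  shows "plot X m U \<beta>"
  using assms(1)[unfolded diffeological_space_def, THEN conjunct2, THEN conjunct1] assms(2,3) by blast

lemma plot_const:
  assumes "diffeological_space X" "euclidean_domain m U" "x \<in> pts X"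
  shows "plot X m U (\<lambda>_. x)"
  using assms(1)[unfolded diffeological_space_def, THEN conjunct2, THEN conjunct2, THEN conjunct1]
    assms(2,3) by blast

lemma plot_compose_smooth_map:
  assumes "diffeological_space X" "plot X m U \<alpha>" "smooth_map n V m U h"
  shows "plot X n V (\<alpha> \<circ> h)"
  using assms(1)[unfolded diffeological_space_def, THEN conjunct2, THEN conjunct2, THEN conjunct2,
      THEN conjunct1] assms(2,3) by blast

lemma plot_locally:
  assumes X: "diffeological_space X" and U: "euclidean_domain m U"
    and loc: "\<And>t. t \<in> U \<Longrightarrow> \<exists>V. euclidean_domain m V \<and> t \<in> V \<and> V \<subseteq> U \<and> plot X m V \<alpha>"
  shows "plot X m U \<alpha>"
proof -
  let ?C = "{V. euclidean_domain m V \<and> V \<subseteq> U \<and> plot X m V \<alpha>}"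
  have "\<Union>?C = U" using loc by blast
  moreover have "\<forall>V\<in>?C. euclidean_domain m V \<and> plot X m V \<alpha>" by blast
  moreover have "\<forall>m U \<alpha> \<V>. euclidean_domain m U \<longrightarrow> \<Union>\<V> = U \<longrightarrow>
        (\<forall>V\<in>\<V>. euclidean_domain m V \<and> plot X m V \<alpha>) \<longrightarrow> plot X m U \<alpha>"
    using X unfolding diffeological_space_def by (elim conjE) assumption
  ultimately show ?thesis using U by blast
qed

lemma Ck_on_const: "Ck_on k n V (\<lambda>x. c)"
proof (induction k arbitrary: c)
  case (Suc k)
  show ?case by (auto intro!: exI[of _ "\<lambda>x. 0"] Suc.IH)
qed simp

lemma Ck_on_coordinate: "Ck_on k n V (\<lambda>x. x j)"
proof -
  have cont: "continuous_map (subtopology (Euclidean_space n) V) euclideanreal (\<lambda>x. x j)"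
    unfolding Euclidean_space_def
    by (intro continuous_map_from_subtopology continuous_map_product_projection) simp
  show ?thesis
  proof (cases k)
    case (Suc k')
    have "((\<lambda>t. (x(i := t)) j) has_real_derivative (if i = j then 1 else 0)) (at (x i))"
      for x :: rseq and i
      by (cases "i = j") auto
    then have "\<exists>f'. (\<forall>x\<in>V. ((\<lambda>t. (x(i := t)) j) has_real_derivative f' x) (at (x i))) \<and>
        Ck_on k' n V f'" for i
      by (intro exI[of _ "\<lambda>x. if i = j then 1 else 0"]) (auto simp: Ck_on_const)
    then show ?thesis using Suc cont by simp
  qed (simp add: cont)
qed

text \<open>
  Restriction is composition with the inclusion of a smaller domain, which is smooth because its
  components are coordinate functions.
\<close>

lemma plot_restrict:
  assumes "diffeological_space X" "plot X m U \<alpha>" "euclidean_domain m V" "V \<subseteq> U"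
  shows "plot X m V \<alpha>"
proof -
  have "smooth_map m V m U id"
    using assms plot_domain[OF assms(1,2)] by (auto simp: smooth_map_def Ck_on_coordinate)
  from plot_compose_smooth_map[OF assms(1,2) this] show ?thesis by simp
qed

lemma dsmooth_plot: "dsmooth X Y f \<Longrightarrow> plot X m U \<alpha> \<Longrightarrow> plot Y m U (\<lambda>t. f (\<alpha> t))"
  unfolding dsmooth_def o_def by blast

lemma dsmooth_in_pts: "dsmooth X Y f \<Longrightarrow> x \<in> pts X \<Longrightarrow> f x \<in> pts Y"
  unfolding dsmooth_def by blast

lemma dsmooth_cong:
  assumes "diffeological_space X" "diffeological_space Y" "dsmooth X Y f"
    and "\<And>x. x \<in> pts X \<Longrightarrow> g x = f x"
  shows "dsmooth X Y g"
  unfolding dsmooth_def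
proof (intro conjI allI impI)
  show "g ` pts X \<subseteq> pts Y" using assms(3,4) unfolding dsmooth_def by force
  fix m U \<alpha> assume \<alpha>: "plot X m U \<alpha>"
  show "plot Y m U (g \<circ> \<alpha>)"
    by (rule plot_cong[OF assms(2) dsmooth_plot[OF assms(3) \<alpha>]])
      (simp add: assms(4) plot_in_pts[OF assms(1) \<alpha>])
qed

lemma pts_fib_prod [simp]:
  "pts (fib_prod X Y f g) = {(x, y). x \<in> pts X \<and> y \<in> pts Y \<and> f x = g y}"
  by (simp add: fib_prod_def sub_space_def)

lemma plot_fib_prod:
  assumes "diffeological_space X" "diffeological_space Y"
  shows "plot (fib_prod X Y f g) m U \<alpha> \<longleftrightarrow>
    plot X m U (\<lambda>t. fst (\<alpha> t)) \<and> plot Y m U (\<lambda>t. snd (\<alpha> t)) \<and> (\<forall>t\<in>U. f (fst (\<alpha> t)) = g (snd (\<alpha> t)))"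
  using plot_in_pts[OF assms(1)] plot_in_pts[OF assms(2)]
  by (auto simp: fib_prod_def sub_space_def prod_space_def o_def image_subset_iff case_prod_beta)

lemma diffeological_space_fib_prod:
  assumes X: "diffeological_space X" and Y: "diffeological_space Y"
  shows "diffeological_space (fib_prod X Y f g)"
  unfolding diffeological_space_def plot_fib_prod[OF X Y]
proof (intro conjI allI impI; (elim conjE)?)
  fix m U \<alpha> assume \<alpha>: "plot X m U (\<lambda>t. fst (\<alpha> t))" "plot Y m U (\<lambda>t. snd (\<alpha> t))"
    and eq: "\<forall>t\<in>U. f (fst (\<alpha> t)) = g (snd (\<alpha> t))"
  show "euclidean_domain m U" by (rule plot_domain[OF X \<alpha>(1)])
  show "\<alpha> ` U \<subseteq> pts (fib_prod X Y f g)"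
    using plot_in_pts[OF X \<alpha>(1)] plot_in_pts[OF Y \<alpha>(2)] eq
    by (simp add: image_subset_iff case_prod_beta)
  fix \<beta> assume \<beta>: "\<forall>t\<in>U. \<beta> t = \<alpha> t"
  show "plot X m U (\<lambda>t. fst (\<beta> t))" by (rule plot_cong[OF X \<alpha>(1)]) (simp add: \<beta>)
  show "plot Y m U (\<lambda>t. snd (\<beta> t))" by (rule plot_cong[OF Y \<alpha>(2)]) (simp add: \<beta>)
  show "\<forall>t\<in>U. f (fst (\<beta> t)) = g (snd (\<beta> t))" using eq \<beta> by simp
next
  fix m U \<alpha> n V h assume \<alpha>: "plot X m U (\<lambda>t. fst (\<alpha> t))" "plot Y m U (\<lambda>t. snd (\<alpha> t))"
    and eq: "\<forall>t\<in>U. f (fst (\<alpha> t)) = g (snd (\<alpha> t))" and h: "smooth_map n V m U h"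
  show "plot X n V (\<lambda>t. fst ((\<alpha> \<circ> h) t))" "plot Y n V (\<lambda>t. snd ((\<alpha> \<circ> h) t))"
    using plot_compose_smooth_map[OF X \<alpha>(1) h] plot_compose_smooth_map[OF Y \<alpha>(2) h]
    by (simp_all add: o_def)
  show "\<forall>t\<in>V. f (fst ((\<alpha> \<circ> h) t)) = g (snd ((\<alpha> \<circ> h) t))"
    using h eq by (auto simp: smooth_map_def)
next
  fix m U \<alpha> \<V>
  assume U: "euclidean_domain m U" "\<Union>\<V> = U"
    and V: "\<forall>V\<in>\<V>. euclidean_domain m V \<and> plot X m V (\<lambda>t. fst (\<alpha> t)) \<and>
      plot Y m V (\<lambda>t. snd (\<alpha> t)) \<and> (\<forall>t\<in>V. f (fst (\<alpha> t)) = g (snd (\<alpha> t)))"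
  show "plot X m U (\<lambda>t. fst (\<alpha> t))"
    using U V by (intro plot_locally[OF X]) blast+
  show "plot Y m U (\<lambda>t. snd (\<alpha> t))"
    using U V by (intro plot_locally[OF Y]) blast+
  show "\<forall>t\<in>U. f (fst (\<alpha> t)) = g (snd (\<alpha> t))"
    using U V by blast
qed (auto intro: plot_const[OF X] plot_const[OF Y])

lemma dsmooth_fib_prodI:
  assumes "diffeological_space X" "diffeological_space Y"
    and "\<And>x y. x \<in> pts X \<Longrightarrow> y \<in> pts Y \<Longrightarrow> u x = v y \<Longrightarrow> f x y \<in> pts Z"
    and "\<And>m U a b. plot X m U a \<Longrightarrow> plot Y m U b \<Longrightarrow> (\<And>t. t \<in> U \<Longrightarrow> a t \<in> pts X) \<Longrightarrow>
      (\<And>t. t \<in> U \<Longrightarrow> b t \<in> pts Y) \<Longrightarrow> (\<And>t. t \<in> U \<Longrightarrow> u (a t) = v (b t)) \<Longrightarrow>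
      plot Z m U (\<lambda>t. f (a t) (b t))"
  shows "dsmooth (fib_prod X Y u v) Z (\<lambda>(x, y). f x y)"
  unfolding dsmooth_def
proof (intro conjI allI impI)
  show "(\<lambda>(x, y). f x y) ` pts (fib_prod X Y u v) \<subseteq> pts Z"
    using assms(3) by auto
  fix m U \<alpha> assume "plot (fib_prod X Y u v) m U \<alpha>"
  then have \<alpha>: "plot X m U (\<lambda>t. fst (\<alpha> t))" "plot Y m U (\<lambda>t. snd (\<alpha> t))"
    "\<forall>t\<in>U. u (fst (\<alpha> t)) = v (snd (\<alpha> t))"
    by (simp_all add: plot_fib_prod[OF assms(1,2)])
  have "plot Z m U (\<lambda>t. f (fst (\<alpha> t)) (snd (\<alpha> t)))"
    by (rule assms(4)[OF \<alpha>(1,2) plot_in_pts[OF assms(1) \<alpha>(1)] plot_in_pts[OF assms(2) \<alpha>(2)]])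
      (use \<alpha>(3) in auto)
  then show "plot Z m U ((\<lambda>(x, y). f x y) \<circ> \<alpha>)"
    by (simp add: o_def case_prod_beta)
qed

lemma dsmooth_fib_prodD:
  assumes "dsmooth (fib_prod X Y u v) Z (\<lambda>(x, y). f x y)"
    and "diffeological_space X" "diffeological_space Y"
    and "plot X m U a" "plot Y m U b" "\<And>t. t \<in> U \<Longrightarrow> u (a t) = v (b t)"
  shows "plot Z m U (\<lambda>t. f (a t) (b t))"
  using dsmooth_plot[OF assms(1), of m U "\<lambda>t. (a t, b t)"] assms
  by (simp add: plot_fib_prod)

lemma diffeomorphism_iff_inverse:
  assumes X: "diffeological_space X" and Y: "diffeological_space Y"
  shows "diffeomorphism X Y f \<longleftrightarrow> dsmooth X Y f \<and>
    (\<exists>g. dsmooth Y X g \<and> (\<forall>x\<in>pts X. g (f x) = x) \<and> (\<forall>y\<in>pts Y. f (g y) = y))"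
proof
  assume "diffeomorphism X Y f"
  then show "dsmooth X Y f \<and> (\<exists>g. dsmooth Y X g \<and> (\<forall>x\<in>pts X. g (f x) = x) \<and> (\<forall>y\<in>pts Y. f (g y) = y))"
    unfolding diffeomorphism_def
    by (auto intro!: exI[of _ "inv_into (pts X) f"]
        simp: bij_betw_inv_into_left bij_betw_inv_into_right)
next
  assume "dsmooth X Y f \<and> (\<exists>g. dsmooth Y X g \<and> (\<forall>x\<in>pts X. g (f x) = x) \<and> (\<forall>y\<in>pts Y. f (g y) = y))"
  then obtain g where f: "dsmooth X Y f" and g: "dsmooth Y X g"
    and gf: "\<And>x. x \<in> pts X \<Longrightarrow> g (f x) = x" and fg: "\<And>y. y \<in> pts Y \<Longrightarrow> f (g y) = y"
    by blast
  have b: "bij_betw f (pts X) (pts Y)"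
    by (rule bij_betw_byWitness[of _ g]) (use f g gf fg in \<open>auto simp: dsmooth_def\<close>)
  moreover have "dsmooth Y X (inv_into (pts X) f)"
    by (rule dsmooth_cong[OF Y X g])
      (metis b bij_betw_inv_into_left dsmooth_in_pts[OF g] fg)
  ultimately show "diffeomorphism X Y f" using f by (simp add: diffeomorphism_def)
qed

lemma diffeomorphism_cong:
  assumes "diffeological_space X" "diffeological_space Y" "diffeomorphism X Y f"
    and "\<And>x. x \<in> pts X \<Longrightarrow> g x = f x"
  shows "diffeomorphism X Y g"
proof -
  have "dsmooth X Y g"
    using dsmooth_cong[OF assms(1,2) _ assms(4)] assms(3) by (simp add: diffeomorphism_def)
  then show ?thesis
    using assms(3,4) unfolding diffeomorphism_iff_inverse[OF assms(1,2)]
    by (metis dsmooth_in_pts)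
qed

lemma diffeomorphismI:
  assumes "diffeological_space X" "diffeological_space Y" "dsmooth X Y f" "dsmooth Y X g"
    and "\<And>x. x \<in> pts X \<Longrightarrow> g (f x) = x" "\<And>y. y \<in> pts Y \<Longrightarrow> f (g y) = y"
  shows "diffeomorphism X Y f"
  using assms by (auto simp: diffeomorphism_iff_inverse)

lemma diffeomorphismE:
  assumes "diffeomorphism X Y f" "diffeological_space X" "diffeological_space Y"
  obtains g where "dsmooth X Y f" "dsmooth Y X g"
    "\<And>x. x \<in> pts X \<Longrightarrow> g (f x) = x" "\<And>y. y \<in> pts Y \<Longrightarrow> f (g y) = y"
  using assms(1) unfolding diffeomorphism_iff_inverse[OF assms(2,3)] by metis

lemma diffeomorphism_compose:
  assumes "diffeological_space X" "diffeological_space Y" "diffeological_space Z"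
    and f: "diffeomorphism X Y f" and g: "diffeomorphism Y Z g"
  shows "diffeomorphism X Z (\<lambda>x. g (f x))"
proof -
  obtain f' where f': "dsmooth X Y f" "dsmooth Y X f'"
    "\<And>x. x \<in> pts X \<Longrightarrow> f' (f x) = x" "\<And>y. y \<in> pts Y \<Longrightarrow> f (f' y) = y"
    by (rule diffeomorphismE[OF f assms(1,2)]) (rule that; assumption)
  obtain g' where g': "dsmooth Y Z g" "dsmooth Z Y g'"
    "\<And>x. x \<in> pts Y \<Longrightarrow> g' (g x) = x" "\<And>y. y \<in> pts Z \<Longrightarrow> g (g' y) = y"
    by (rule diffeomorphismE[OF g assms(2,3)]) (rule that; assumption)
  have comp: "dsmooth A C (\<lambda>a. v (u a))" if "dsmooth A B u" "dsmooth B C v" for A B C u v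
    using that by (auto simp: dsmooth_def o_def image_subset_iff)
  show ?thesis
    by (rule diffeomorphismI[OF assms(1,3) comp[OF f'(1) g'(1)] comp[OF g'(2) f'(2)]])
      (simp_all add: f'(3,4) g'(3,4) dsmooth_in_pts[OF f'(1)] dsmooth_in_pts[OF g'(2)])
qed

lemma diffeomorphism_swap:
  assumes "diffeological_space X" "diffeological_space Y"
  shows "diffeomorphism (fib_prod X Y f g) (fib_prod Y X g f) (\<lambda>(x, y). (y, x))"
proof -
  have *: "dsmooth (fib_prod X Y f g) (fib_prod Y X g f) (\<lambda>(x, y). (y, x))"
    if "diffeological_space X" "diffeological_space Y" for X Y f g
    by (rule dsmooth_fib_prodI[OF that]) (auto simp: plot_fib_prod[OF that(2,1)])
  show ?thesis
    using diffeomorphismI[OF diffeological_space_fib_prod diffeological_space_fib_prod, OF assms assms(2,1)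
        *[OF assms] *[OF assms(2,1)]] by auto
qed

section \<open>Subductions and quotients\<close>

lemma subduction_lift:
  assumes "subduction X Y f" "plot Y m U \<alpha>" "t \<in> U"
  obtains V \<beta> where "euclidean_domain m V" "t \<in> V" "V \<subseteq> U" "plot X m V \<beta>" "\<And>s. s \<in> V \<Longrightarrow> \<alpha> s = f (\<beta> s)"
  using assms(1)[unfolded subduction_def, THEN conjunct2, THEN conjunct2] assms(2,3) by metis

lemma subductionI:
  assumes "dsmooth X Y f" "\<And>y. y \<in> pts Y \<Longrightarrow> \<exists>x\<in>pts X. f x = y"
    and "\<And>m U \<alpha> t. plot Y m U \<alpha> \<Longrightarrow> t \<in> U \<Longrightarrow>
      \<exists>V \<beta>. euclidean_domain m V \<and> t \<in> V \<and> V \<subseteq> U \<and> plot X m V \<beta> \<and> (\<forall>s\<in>V. \<alpha> s = f (\<beta> s))"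
  shows "subduction X Y f"
  unfolding subduction_def
proof (intro conjI allI impI ballI)
  show "f ` pts X = pts Y"
    using dsmooth_in_pts[OF assms(1)] assms(2) by blast
qed (use assms(1,3) in auto)

lemma subduction_smooth: "subduction X Y f \<Longrightarrow> dsmooth X Y f"
  unfolding subduction_def by (elim conjE) assumption

lemma subduction_image: "subduction X Y f \<Longrightarrow> f ` pts X = pts Y"
  unfolding subduction_def by (elim conjE) assumption

lemma subduction_onto: "subduction X Y f \<Longrightarrow> y \<in> pts Y \<Longrightarrow> \<exists>x\<in>pts X. f x = y"
  using subduction_image[of X Y f] by (metis imageE)

lemma quot_space_lift:
  assumes "plot (quot_space A r) m U \<alpha>" "t \<in> U"
  obtains V \<beta> where "euclidean_domain m V" "t \<in> V" "V \<subseteq> U" "plot A m V \<beta>"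
    "\<And>s. s \<in> V \<Longrightarrow> \<alpha> s = r `` {\<beta> s}"
proof -
  have "\<forall>t\<in>U. \<exists>V \<beta>. euclidean_domain m V \<and> t \<in> V \<and> V \<subseteq> U \<and> plot A m V \<beta> \<and>
      (\<forall>s\<in>V. \<alpha> s = r `` {\<beta> s})"
    using assms(1) by (simp add: quot_space_def)
  with assms(2) that show thesis by metis
qed

text \<open>
  A subduction exhibits its codomain as the quotient by its kernel: the local lifts along the
  subduction are exactly what makes the inverse of the induced bijection smooth.
\<close>

lemma diffeomorphism_quot_spaceI:
  assumes A: "diffeological_space A" and B: "diffeological_space B"
    and p: "subduction A B p" and r: "equiv (pts A) r"
    and ker: "\<And>a b. a \<in> pts A \<Longrightarrow> b \<in> pts A \<Longrightarrow> p a = p b \<longleftrightarrow> (a, b) \<in> r"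
    and \<phi>: "\<And>a. a \<in> pts A \<Longrightarrow> \<phi> (r `` {a}) = p a"
  shows "diffeomorphism (quot_space A r) B \<phi>"
proof -
  have pts: "pts (quot_space A r) = pts A // r" by (simp add: quot_space_def)
  have inj: "inj_on \<phi> (pts A // r)"
    by (rule inj_onI, elim quotientE) (metis \<phi> ker equiv_class_eq[OF r])
  have img: "\<phi> ` (pts A // r) = pts B"
  proof
    show "\<phi> ` (pts A // r) \<subseteq> pts B"
      using dsmooth_in_pts[OF subduction_smooth[OF p]] by (auto elim!: quotientE simp: \<phi>)
    show "pts B \<subseteq> \<phi> ` (pts A // r)"
      using subduction_onto[OF p] by (metis \<phi> image_eqI quotientI subsetI)
  qed
  have "dsmooth (quot_space A r) B \<phi>"
    unfolding dsmooth_def pts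
  proof (intro conjI allI impI)
    fix m U \<alpha> assume \<alpha>: "plot (quot_space A r) m U \<alpha>"
    then have U: "euclidean_domain m U" by (simp add: quot_space_def)
    show "plot B m U (\<phi> \<circ> \<alpha>)"
    proof (rule plot_locally[OF B U])
      fix t assume "t \<in> U"
      from quot_space_lift[OF \<alpha> this] obtain V \<beta> where V: "euclidean_domain m V" "t \<in> V" "V \<subseteq> U"
        and \<beta>: "plot A m V \<beta>" "\<And>s. s \<in> V \<Longrightarrow> \<alpha> s = r `` {\<beta> s}" by metis
      have "plot B m V (\<phi> \<circ> \<alpha>)"
        by (rule plot_cong[OF B dsmooth_plot[OF subduction_smooth[OF p] \<beta>(1)]])
          (simp add: \<beta> \<phi> plot_in_pts[OF A \<beta>(1)])
      with V show "\<exists>V. euclidean_domain m V \<and> t \<in> V \<and> V \<subseteq> U \<and> plot B m V (\<phi> \<circ> \<alpha>)" by blast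
    qed
  qed (use img in blast)
  moreover have "dsmooth B (quot_space A r) (inv_into (pts A // r) \<phi>)"
    unfolding dsmooth_def pts
  proof (intro conjI allI impI)
    show "inv_into (pts A // r) \<phi> ` pts B \<subseteq> pts A // r"
      using img by (metis image_subsetI inv_into_into)
    fix m U \<gamma> assume \<gamma>: "plot B m U \<gamma>"
    show "plot (quot_space A r) m U (inv_into (pts A // r) \<phi> \<circ> \<gamma>)"
      unfolding quot_space_def dspace.simps
    proof (intro conjI ballI)
      show "euclidean_domain m U" by (rule plot_domain[OF B \<gamma>])
      show "(inv_into (pts A // r) \<phi> \<circ> \<gamma>) ` U \<subseteq> pts A // r"
        using img plot_in_pts[OF B \<gamma>] by (auto intro!: inv_into_into)
      fix t assume "t \<in> U"
      from subduction_lift[OF p \<gamma> this] obtain V \<beta> where V: "euclidean_domain m V" "t \<in> V" "V \<subseteq> U"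
        and \<beta>: "plot A m V \<beta>" "\<And>s. s \<in> V \<Longrightarrow> \<gamma> s = p (\<beta> s)" by metis
      have "(inv_into (pts A // r) \<phi> \<circ> \<gamma>) s = r `` {\<beta> s}" if "s \<in> V" for s
        using that plot_in_pts[OF A \<beta>(1) that] inv_into_f_f[OF inj quotientI[of "\<beta> s" "pts A" r]]
        by (simp add: \<beta> \<phi>)
      with V \<beta> show "\<exists>V \<beta>. euclidean_domain m V \<and> t \<in> V \<and> V \<subseteq> U \<and> plot A m V \<beta> \<and>
            (\<forall>s\<in>V. (inv_into (pts A // r) \<phi> \<circ> \<gamma>) s = r `` {\<beta> s})" by blast
    qed
  qed
  ultimately show ?thesis
    by (simp add: diffeomorphism_def pts bij_betw_def inj img)
qed

text \<open>
  The projection to a quotient is a subduction by the definition of the quotient plots, and this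
  survives composition with a diffeomorphism.
\<close>

lemma subduction_of_diffeomorphism_quot_space:
  assumes A: "diffeological_space A" and B: "diffeological_space B"
    and \<phi>: "diffeomorphism (quot_space A r) B \<phi>"
  shows "subduction A B (\<lambda>a. \<phi> (r `` {a}))"
proof -
  have pts: "pts (quot_space A r) = pts A // r" by (simp add: quot_space_def)
  have \<phi>': "dsmooth (quot_space A r) B \<phi>" "bij_betw \<phi> (pts A // r) (pts B)"
    "dsmooth B (quot_space A r) (inv_into (pts A // r) \<phi>)"
    using \<phi> by (simp_all add: diffeomorphism_def pts)
  have proj: "dsmooth A (quot_space A r) (\<lambda>a. r `` {a})"
    unfolding dsmooth_def quot_space_def dspace.simps
    using plot_domain[OF A] plot_in_pts[OF A] by (fastforce intro: quotientI)
  show ?thesis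
  proof (rule subductionI)
    show "dsmooth A B (\<lambda>a. \<phi> (r `` {a}))"
      using dsmooth_plot[OF \<phi>'(1) dsmooth_plot[OF proj]] \<phi>'(1) proj
      by (fastforce simp: dsmooth_def o_def)
    fix y assume "y \<in> pts B"
    then obtain c where "c \<in> pts A // r" "\<phi> c = y" using \<phi>'(2) unfolding bij_betw_def by (metis imageE)
    then show "\<exists>x\<in>pts A. \<phi> (r `` {x}) = y" by (auto elim: quotientE)
  next
    fix m U \<gamma> t assume \<gamma>: "plot B m U \<gamma>" and t: "t \<in> U"
    from quot_space_lift[OF dsmooth_plot[OF \<phi>'(3) \<gamma>] t] obtain V \<beta> where V: "euclidean_domain m V" "t \<in> V" "V \<subseteq> U" "plot A m V \<beta>"
      and \<beta>: "\<And>s. s \<in> V \<Longrightarrow> inv_into (pts A // r) \<phi> (\<gamma> s) = r `` {\<beta> s}"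
      by metis
    have "\<gamma> s = \<phi> (r `` {\<beta> s})" if "s \<in> V" for s
      using that V(3) by (metis \<beta> \<phi>'(2) bij_betw_inv_into_right plot_in_pts[OF B \<gamma>] subsetD)
    with V show "\<exists>V \<beta>. euclidean_domain m V \<and> t \<in> V \<and> V \<subseteq> U \<and> plot A m V \<beta> \<and>
      (\<forall>s\<in>V. \<gamma> s = \<phi> (r `` {\<beta> s}))" by blast
  qed
qed

section \<open>Groupoids and bibundles\<close>

locale smooth_groupoid =
  fixes G :: "('o, 'a) dgroupoid"
  assumes diffeological: "diffeological_groupoid G"
begin

lemma gpd: "groupoid G" and obj_space: "diffeological_space (obj G)"
  and arr_space: "diffeological_space (arr G)"
  and src_smooth: "dsmooth (arr G) (obj G) (src G)"
  and ident_smooth: "dsmooth (obj G) (arr G) (ident G)"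
  and inv_smooth: "dsmooth (arr G) (arr G) (ginv G)"
  and comp_smooth: "dsmooth (fib_prod (arr G) (arr G) (src G) (trg G)) (arr G) (\<lambda>(g, h). gcomp G g h)"
  using diffeological unfolding diffeological_groupoid_def by blast+

lemma src_in: "g \<in> pts (arr G) \<Longrightarrow> src G g \<in> pts (obj G)"
  and trg_in: "g \<in> pts (arr G) \<Longrightarrow> trg G g \<in> pts (obj G)"
  and ident_in: "a \<in> pts (obj G) \<Longrightarrow> ident G a \<in> pts (arr G)"
  and src_ident: "a \<in> pts (obj G) \<Longrightarrow> src G (ident G a) = a"
  and trg_ident: "a \<in> pts (obj G) \<Longrightarrow> trg G (ident G a) = a"
  and comp_in: "g \<in> pts (arr G) \<Longrightarrow> h \<in> pts (arr G) \<Longrightarrow> src G g = trg G h \<Longrightarrow>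
    gcomp G g h \<in> pts (arr G)"
  and src_comp: "g \<in> pts (arr G) \<Longrightarrow> h \<in> pts (arr G) \<Longrightarrow> src G g = trg G h \<Longrightarrow>
    src G (gcomp G g h) = src G h"
  and trg_comp: "g \<in> pts (arr G) \<Longrightarrow> h \<in> pts (arr G) \<Longrightarrow> src G g = trg G h \<Longrightarrow>
    trg G (gcomp G g h) = trg G g"
  and comp_assoc: "f \<in> pts (arr G) \<Longrightarrow> g \<in> pts (arr G) \<Longrightarrow> h \<in> pts (arr G) \<Longrightarrow>
    src G f = trg G g \<Longrightarrow> src G g = trg G h \<Longrightarrow>
    gcomp G (gcomp G f g) h = gcomp G f (gcomp G g h)"
  and comp_ident: "g \<in> pts (arr G) \<Longrightarrow> gcomp G g (ident G (src G g)) = g"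
  and ident_comp: "g \<in> pts (arr G) \<Longrightarrow> gcomp G (ident G (trg G g)) g = g"
  and inv_in: "g \<in> pts (arr G) \<Longrightarrow> ginv G g \<in> pts (arr G)"
  and src_inv: "g \<in> pts (arr G) \<Longrightarrow> src G (ginv G g) = trg G g"
  and trg_inv: "g \<in> pts (arr G) \<Longrightarrow> trg G (ginv G g) = src G g"
  and inv_comp: "g \<in> pts (arr G) \<Longrightarrow> gcomp G (ginv G g) g = ident G (src G g)"
  and comp_inv: "g \<in> pts (arr G) \<Longrightarrow> gcomp G g (ginv G g) = ident G (trg G g)"
  using gpd unfolding groupoid_def by blast+

lemmas gpd_simps = src_in trg_in ident_in src_ident trg_ident comp_in src_comp trg_comp
  comp_ident ident_comp inv_in src_inv trg_inv inv_comp comp_inv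

lemma inv_unique:
  assumes "g \<in> pts (arr G)" "h \<in> pts (arr G)" "src G g = trg G h" "gcomp G g h = ident G (trg G g)"
  shows "h = ginv G g"
proof -
  have "gcomp G (ginv G g) (gcomp G g h) = h"
    using assms comp_assoc[of "ginv G g" g h] by (simp add: gpd_simps)
  moreover have "gcomp G (ginv G g) (gcomp G g h) = ginv G g"
    using assms comp_ident[of "ginv G g"] by (simp add: gpd_simps)
  ultimately show ?thesis by simp
qed

lemma inv_inv: "g \<in> pts (arr G) \<Longrightarrow> ginv G (ginv G g) = g"
  using inv_unique[of "ginv G g" g] by (simp add: gpd_simps)

lemma inv_of_ident: "a \<in> pts (obj G) \<Longrightarrow> ginv G (ident G a) = ident G a"
  using inv_unique[of "ident G a" "ident G a"] comp_ident[of "ident G a"] by (simp add: gpd_simps)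

lemma comp_inv_cancel:
  assumes "g \<in> pts (arr G)" "h \<in> pts (arr G)" "src G g = src G h"
  shows "gcomp G (gcomp G g (ginv G h)) h = g"
  using assms comp_assoc[of g "ginv G h" h] comp_ident[of g] by (simp add: gpd_simps)

lemma inv_comp_distrib:
  assumes "g \<in> pts (arr G)" "h \<in> pts (arr G)" "src G g = trg G h"
  shows "ginv G (gcomp G g h) = gcomp G (ginv G h) (ginv G g)"
proof (rule inv_unique[symmetric])
  have "gcomp G h (gcomp G (ginv G h) (ginv G g)) = ginv G g"
    using assms comp_assoc[of h "ginv G h" "ginv G g"] ident_comp[of "ginv G g"]
    by (simp add: gpd_simps)
  then show "gcomp G (gcomp G g h) (gcomp G (ginv G h) (ginv G g)) = ident G (trg G (gcomp G g h))"
    using assms comp_assoc[of g h "gcomp G (ginv G h) (ginv G g)"] by (simp add: gpd_simps)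
qed (use assms in \<open>simp_all add: gpd_simps\<close>)

text \<open>Cancelling \<open>h\<close> on the right is what makes a groupoid act freely on its own arrows.\<close>

lemma eq_ident_if_comp_eq:
  assumes "g \<in> pts (arr G)" "h \<in> pts (arr G)" "src G g = trg G h" "gcomp G g h = h"
  shows "g = ident G (src G g)"
  using comp_assoc[of g h "ginv G h"] comp_ident[of g] assms by (simp add: gpd_simps)

lemmas src_plot = dsmooth_plot[OF src_smooth]
  and ident_plot = dsmooth_plot[OF ident_smooth]
  and inv_plot = dsmooth_plot[OF inv_smooth]
  and comp_plot = dsmooth_fib_prodD[OF comp_smooth arr_space arr_space]

end

locale smooth_bibundle = G: smooth_groupoid G + H: smooth_groupoid H
  for G :: "('g0, 'g) dgroupoid" and H :: "('h0, 'h) dgroupoid" +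
  fixes X :: "('g0, 'g, 'h0, 'h, 'x) bibundle"
  assumes bib: "diffeological_bibundle G H X"
begin

lemma space_diffeological: "diffeological_space (space X)"
  and left_action: "smooth_left_action G (space X) (lmom X) (lact X)"
  and right_action: "smooth_right_action H (space X) (rmom X) (ract X)"
  and lmom_ract: "x \<in> pts (space X) \<Longrightarrow> h \<in> pts (arr H) \<Longrightarrow> rmom X x = trg H h \<Longrightarrow>
    lmom X (ract X x h) = lmom X x"
  and rmom_lact: "g \<in> pts (arr G) \<Longrightarrow> x \<in> pts (space X) \<Longrightarrow> src G g = lmom X x \<Longrightarrow>
    rmom X (lact X g x) = rmom X x"
  and ract_lact: "g \<in> pts (arr G) \<Longrightarrow> x \<in> pts (space X) \<Longrightarrow> h \<in> pts (arr H) \<Longrightarrow>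
    src G g = lmom X x \<Longrightarrow> rmom X x = trg H h \<Longrightarrow>
    ract X (lact X g x) h = lact X g (ract X x h)"
  using bib unfolding diffeological_bibundle_def by blast+

lemma lmom_smooth: "dsmooth (space X) (obj G) (lmom X)"
  and lact_smooth: "dsmooth (fib_prod (arr G) (space X) (src G) (lmom X)) (space X) (\<lambda>(g, x). lact X g x)"
  and lmom_lact: "g \<in> pts (arr G) \<Longrightarrow> x \<in> pts (space X) \<Longrightarrow> src G g = lmom X x \<Longrightarrow>
    lmom X (lact X g x) = trg G g"
  and lact_ident: "x \<in> pts (space X) \<Longrightarrow> lact X (ident G (lmom X x)) x = x"
  and lact_lact: "g \<in> pts (arr G) \<Longrightarrow> h \<in> pts (arr G) \<Longrightarrow> x \<in> pts (space X) \<Longrightarrow>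
    src G g = lmom X x \<Longrightarrow> src G h = trg G g \<Longrightarrow>
    lact X h (lact X g x) = lact X (gcomp G h g) x"
  using left_action unfolding smooth_left_action_def by blast+

lemma rmom_smooth: "dsmooth (space X) (obj H) (rmom X)"
  and ract_smooth: "dsmooth (fib_prod (space X) (arr H) (rmom X) (trg H)) (space X) (\<lambda>(x, h). ract X x h)"
  and rmom_ract: "x \<in> pts (space X) \<Longrightarrow> h \<in> pts (arr H) \<Longrightarrow> rmom X x = trg H h \<Longrightarrow>
    rmom X (ract X x h) = src H h"
  and ract_ident: "x \<in> pts (space X) \<Longrightarrow> ract X x (ident H (rmom X x)) = x"
  and ract_ract: "x \<in> pts (space X) \<Longrightarrow> h \<in> pts (arr H) \<Longrightarrow> h' \<in> pts (arr H) \<Longrightarrow>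
    rmom X x = trg H h \<Longrightarrow> src H h = trg H h' \<Longrightarrow>
    ract X (ract X x h) h' = ract X x (gcomp H h h')"
  using right_action unfolding smooth_right_action_def by blast+

lemma lmom_in: "x \<in> pts (space X) \<Longrightarrow> lmom X x \<in> pts (obj G)"
  and rmom_in: "x \<in> pts (space X) \<Longrightarrow> rmom X x \<in> pts (obj H)"
  using lmom_smooth rmom_smooth by (simp_all add: dsmooth_in_pts)

lemma lact_in: "g \<in> pts (arr G) \<Longrightarrow> x \<in> pts (space X) \<Longrightarrow> src G g = lmom X x \<Longrightarrow>
    lact X g x \<in> pts (space X)"
  and ract_in: "x \<in> pts (space X) \<Longrightarrow> h \<in> pts (arr H) \<Longrightarrow> rmom X x = trg H h \<Longrightarrow>
    ract X x h \<in> pts (space X)"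
  using dsmooth_in_pts[OF lact_smooth, of "(g, x)"] dsmooth_in_pts[OF ract_smooth, of "(x, h)"]
  by simp_all

lemmas bib_simps = lmom_in rmom_in lact_in ract_in lmom_ract rmom_lact lmom_lact rmom_ract
  lact_ident ract_ident

lemma lact_inv_lact: "g \<in> pts (arr G) \<Longrightarrow> x \<in> pts (space X) \<Longrightarrow> src G g = lmom X x \<Longrightarrow>
    lact X (ginv G g) (lact X g x) = x"
  by (simp add: lact_lact G.gpd_simps bib_simps)

lemma ract_ract_inv: "x \<in> pts (space X) \<Longrightarrow> h \<in> pts (arr H) \<Longrightarrow> rmom X x = trg H h \<Longrightarrow>
    ract X (ract X x h) (ginv H h) = x"
  using ract_ident[of x] by (simp add: ract_ract H.gpd_simps bib_simps)

lemmas rmom_plot = dsmooth_plot[OF rmom_smooth]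
  and lact_plot = dsmooth_fib_prodD[OF lact_smooth G.arr_space space_diffeological]
  and ract_plot = dsmooth_fib_prodD[OF ract_smooth space_diffeological H.arr_space]

end

text \<open>
  The opposite bibundle turns left actions into right ones through inversion. It is the weak inverse
  of a biprincipal bibundle, and it reduces statements about the right action to the left one. Taking
  it twice changes the actions only outside of the arrow spaces, where inversion need not be involutive;
  hence the lemma \<open>opposite_opposite\<close> in place of an equation between bibundles.
\<close>

definition opposite ::
  "('g0, 'g) dgroupoid \<Rightarrow> ('h0, 'h) dgroupoid \<Rightarrow> ('g0, 'g, 'h0, 'h, 'x) bibundle \<Rightarrow>
   ('h0, 'h, 'g0, 'g, 'x) bibundle" where
  "opposite G H X =
     \<lparr> space = space X, lmom = rmom X, rmom = lmom X,
       lact = (\<lambda>h x. ract X x (ginv H h)), ract = (\<lambda>x g. lact X (ginv G g) x) \<rparr>"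

lemma opposite_sel [simp]:
  "space (opposite G H X) = space X"
  "lmom (opposite G H X) = rmom X"
  "rmom (opposite G H X) = lmom X"
  "lact (opposite G H X) h x = ract X x (ginv H h)"
  "ract (opposite G H X) x g = lact X (ginv G g) x"
  by (simp_all add: opposite_def)

context smooth_bibundle
begin

lemma diffeological_bibundle_opposite: "diffeological_bibundle H G (opposite G H X)"
  unfolding diffeological_bibundle_def smooth_left_action_def smooth_right_action_def opposite_sel
proof (intro conjI ballI impI)
  show "dsmooth (fib_prod (arr H) (space X) (src H) (rmom X)) (space X) (\<lambda>(h, x). ract X x (ginv H h))"
    by (rule dsmooth_fib_prodI[OF H.arr_space space_diffeological])
      (auto intro!: ract_plot H.inv_plot simp: H.gpd_simps bib_simps)
  show "dsmooth (fib_prod (space X) (arr G) (lmom X) (trg G)) (space X) (\<lambda>(x, g). lact X (ginv G g) x)"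
    by (rule dsmooth_fib_prodI[OF space_diffeological G.arr_space])
      (auto intro!: lact_plot G.inv_plot simp: G.gpd_simps bib_simps)
qed (simp_all add: space_diffeological lmom_smooth rmom_smooth bib_simps G.gpd_simps H.gpd_simps
      G.inv_of_ident H.inv_of_ident G.inv_comp_distrib H.inv_comp_distrib lact_lact ract_ract ract_lact)

lemma smooth_bibundle_opposite: "smooth_bibundle H G (opposite G H X)"
  by unfold_locales (rule diffeological_bibundle_opposite)

lemma opposite_opposite:
  "h \<in> pts (arr H) \<Longrightarrow> ract (opposite H G (opposite G H X)) x h = ract X x h"
  "g \<in> pts (arr G) \<Longrightarrow> lact (opposite H G (opposite G H X)) g x = lact X g x"
  by (simp_all add: G.inv_inv H.inv_inv)

end

section \<open>Principality\<close>

context smooth_bibundle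
begin

lemma left_fib_prod_space: "diffeological_space (fib_prod (arr G) (space X) (src G) (lmom X))"
  and self_fib_prod_space: "diffeological_space (fib_prod (space X) (space X) u v)"
  by (simp_all add: diffeological_space_fib_prod G.arr_space space_diffeological)

text \<open>
  Left pre-principality is the existence of a smooth division map \<open>d\<close>, with \<open>d x y\<close> the unique arrow
  that carries \<open>y\<close> to \<open>x\<close>: it is the first component of the inverse of \<open>(g, x) \<mapsto> (g x, x)\<close>.
\<close>

lemma left_pre_principalI:
  assumes d: "dsmooth (fib_prod (space X) (space X) (rmom X) (rmom X)) (arr G) (\<lambda>(x, y). d x y)"
    and src_d: "\<And>x y. x \<in> pts (space X) \<Longrightarrow> y \<in> pts (space X) \<Longrightarrow> rmom X x = rmom X y \<Longrightarrow>
      src G (d x y) = lmom X y"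
    and lact_d: "\<And>x y. x \<in> pts (space X) \<Longrightarrow> y \<in> pts (space X) \<Longrightarrow> rmom X x = rmom X y \<Longrightarrow>
      lact X (d x y) y = x"
    and d_lact: "\<And>g y. g \<in> pts (arr G) \<Longrightarrow> y \<in> pts (space X) \<Longrightarrow> src G g = lmom X y \<Longrightarrow>
      d (lact X g y) y = g"
  shows "left_pre_principal G H X"
  unfolding left_pre_principal_def
proof (rule diffeomorphismI[OF left_fib_prod_space self_fib_prod_space])
  show "dsmooth (fib_prod (arr G) (space X) (src G) (lmom X))
      (fib_prod (space X) (space X) (rmom X) (rmom X)) (\<lambda>(g, x). (lact X g x, x))"
    by (rule dsmooth_fib_prodI[OF G.arr_space space_diffeological])
      (auto simp: bib_simps plot_fib_prod[OF space_diffeological space_diffeological] intro!: lact_plot)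
  show "dsmooth (fib_prod (space X) (space X) (rmom X) (rmom X))
      (fib_prod (arr G) (space X) (src G) (lmom X)) (\<lambda>(x, y). (d x y, y))"
    using dsmooth_in_pts[OF d]
    by (intro dsmooth_fib_prodI[OF space_diffeological space_diffeological])
      (auto simp: src_d plot_fib_prod[OF G.arr_space space_diffeological]
        intro!: dsmooth_fib_prodD[OF d space_diffeological space_diffeological])
qed (auto simp: lact_d d_lact)

lemma left_pre_principalE:
  assumes "left_pre_principal G H X"
  obtains d where
    "dsmooth (fib_prod (space X) (space X) (rmom X) (rmom X)) (arr G) (\<lambda>(x, y). d x y)"
    "\<And>x y. x \<in> pts (space X) \<Longrightarrow> y \<in> pts (space X) \<Longrightarrow> rmom X x = rmom X y \<Longrightarrow>
      d x y \<in> pts (arr G)"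
    "\<And>x y. x \<in> pts (space X) \<Longrightarrow> y \<in> pts (space X) \<Longrightarrow> rmom X x = rmom X y \<Longrightarrow>
      src G (d x y) = lmom X y"
    "\<And>x y. x \<in> pts (space X) \<Longrightarrow> y \<in> pts (space X) \<Longrightarrow> rmom X x = rmom X y \<Longrightarrow>
      lact X (d x y) y = x"
    "\<And>g y. g \<in> pts (arr G) \<Longrightarrow> y \<in> pts (space X) \<Longrightarrow> src G g = lmom X y \<Longrightarrow>
      d (lact X g y) y = g"
proof -
  obtain k where k: "dsmooth (fib_prod (space X) (space X) (rmom X) (rmom X))
      (fib_prod (arr G) (space X) (src G) (lmom X)) k"
    and kf: "\<And>a. a \<in> pts (fib_prod (arr G) (space X) (src G) (lmom X)) \<Longrightarrow>
      k ((\<lambda>(g, x). (lact X g x, x)) a) = a"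
    and fk: "\<And>b. b \<in> pts (fib_prod (space X) (space X) (rmom X) (rmom X)) \<Longrightarrow>
      (\<lambda>(g, x). (lact X g x, x)) (k b) = b"
    by (rule diffeomorphismE[OF assms[unfolded left_pre_principal_def] left_fib_prod_space
          self_fib_prod_space]) (rule that; assumption)
  have k_in: "fst (k (x, y)) \<in> pts (arr G) \<and> src G (fst (k (x, y))) = lmom X y \<and>
      lact X (fst (k (x, y))) y = x"
    if "x \<in> pts (space X)" "y \<in> pts (space X)" "rmom X x = rmom X y" for x y
    using dsmooth_in_pts[OF k, of "(x, y)"] fk[of "(x, y)"] that by (auto split: prod.splits)
  show thesis
  proof (rule that[of "\<lambda>x y. fst (k (x, y))"])
    show "dsmooth (fib_prod (space X) (space X) (rmom X) (rmom X)) (arr G) (\<lambda>(x, y). fst (k (x, y)))"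
    proof (rule dsmooth_fib_prodI[OF space_diffeological space_diffeological])
      fix m U a b assume "plot (space X) m U a" "plot (space X) m U b"
        and "\<And>t. t \<in> U \<Longrightarrow> rmom X (a t) = rmom X (b t)"
      then show "plot (arr G) m U (\<lambda>t. fst (k (a t, b t)))"
        using dsmooth_plot[OF k, of m U "\<lambda>t. (a t, b t)"]
        by (simp add: plot_fib_prod[OF space_diffeological space_diffeological] plot_fib_prod[OF G.arr_space space_diffeological])
    qed (use k_in in blast)
    show "fst (k (lact X g y, y)) = g"
      if "g \<in> pts (arr G)" "y \<in> pts (space X)" "src G g = lmom X y" for g y
      using kf[of "(g, y)"] that by simp
  qed (use k_in in blast)+
qed

text \<open>
  The map \<open>(h, x) \<mapsto> (x h\<^sup>-\<^sup>1, x)\<close> of the opposite bibundle is \<open>(x, h) \<mapsto> (x, x h)\<close> conjugated by two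
  diffeomorphisms: \<open>(h, x) \<mapsto> (x, h\<^sup>-\<^sup>1)\<close> on the domain and the swap on the codomain.
\<close>

lemma right_pre_principal_iff_opposite:
  "right_pre_principal G H X \<longleftrightarrow> left_pre_principal H G (opposite G H X)"
proof -
  let ?L = "fib_prod (arr H) (space X) (src H) (rmom X)"
    and ?R = "fib_prod (space X) (arr H) (rmom X) (trg H)"
    and ?S = "fib_prod (space X) (space X) (lmom X) (lmom X)"
  let ?u = "\<lambda>(h, x). (x, ginv H h)" and ?v = "\<lambda>(x, h). (ginv H h, x)" and ?w = "\<lambda>(x, y). (y, x)"
  have L: "diffeological_space ?L" and R: "diffeological_space ?R" and S: "diffeological_space ?S"
    by (simp_all add: diffeological_space_fib_prod H.arr_space space_diffeological)
  have u: "dsmooth ?L ?R ?u"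
    by (rule dsmooth_fib_prodI[OF H.arr_space space_diffeological])
      (auto simp: plot_fib_prod[OF space_diffeological H.arr_space] H.gpd_simps intro!: H.inv_plot)
  have v: "dsmooth ?R ?L ?v"
    by (rule dsmooth_fib_prodI[OF space_diffeological H.arr_space])
      (auto simp: plot_fib_prod[OF H.arr_space space_diffeological] H.gpd_simps intro!: H.inv_plot)
  have uv: "diffeomorphism ?L ?R ?u" "diffeomorphism ?R ?L ?v"
    by (rule diffeomorphismI[OF L R u v] diffeomorphismI[OF R L v u]; auto simp: H.inv_inv)+
  have w: "diffeomorphism ?S ?S ?w" by (rule diffeomorphism_swap[OF space_diffeological space_diffeological])
  show ?thesis
    unfolding left_pre_principal_def right_pre_principal_def opposite_sel
  proof
    assume f: "diffeomorphism ?R ?S (\<lambda>(x, h). (x, ract X x h))"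
    show "diffeomorphism ?L ?S (\<lambda>(h, x). (ract X x (ginv H h), x))"
      by (rule diffeomorphism_cong[OF L S diffeomorphism_compose[OF L S S
            diffeomorphism_compose[OF L R S uv(1) f] w]]) auto
  next
    assume f: "diffeomorphism ?L ?S (\<lambda>(h, x). (ract X x (ginv H h), x))"
    show "diffeomorphism ?R ?S (\<lambda>(x, h). (x, ract X x h))"
      by (rule diffeomorphism_cong[OF R S diffeomorphism_compose[OF R S S
            diffeomorphism_compose[OF R L S uv(2) f] w]]) (auto simp: H.inv_inv)
  qed
qed

lemma biprincipal_iff_opposite:
  "biprincipal G H X \<longleftrightarrow> left_principal G H X \<and> left_principal H G (opposite G H X)"
  by (simp add: biprincipal_def left_principal_def right_principal_def left_subductive_def
      right_subductive_def right_pre_principal_iff_opposite)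

lemma left_principal_opposite_opposite:
  assumes "left_principal G H X"
  shows "left_principal G H (opposite H G (opposite G H X))"
proof -
  have "left_pre_principal G H (opposite H G (opposite G H X))"
    using assms diffeomorphism_cong[OF left_fib_prod_space self_fib_prod_space]
    unfolding left_principal_def left_pre_principal_def
    by (fastforce simp: G.inv_inv)
  with assms show ?thesis by (simp add: left_principal_def left_subductive_def)
qed

end

section \<open>Perfect pairings\<close>

text \<open>
  A perfect pairing is an isomorphism from \<open>X \<otimes>\<^sub>H Y\<close> to the identity bibundle of \<open>G\<close>, expressed on
  representatives: subductivity and the description of the fibres together say that the induced map
  on classes is a diffeomorphism.
\<close>

locale perfect_pairing = X: smooth_bibundle G H X + Y: smooth_bibundle H G Y
  for G :: "('g0, 'g) dgroupoid" and H :: "('h0, 'h) dgroupoid"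
    and X :: "('g0, 'g, 'h0, 'h, 'x) bibundle" and Y :: "('h0, 'h, 'g0, 'g, 'y) bibundle" +
  fixes p :: "'x \<Rightarrow> 'y \<Rightarrow> 'g"
  assumes p_subduction:
      "subduction (fib_prod (space X) (space Y) (rmom X) (lmom Y)) (arr G) (\<lambda>(x, y). p x y)"
    and trg_p: "x \<in> pts (space X) \<Longrightarrow> y \<in> pts (space Y) \<Longrightarrow> rmom X x = lmom Y y \<Longrightarrow>
      trg G (p x y) = lmom X x"
    and src_p: "x \<in> pts (space X) \<Longrightarrow> y \<in> pts (space Y) \<Longrightarrow> rmom X x = lmom Y y \<Longrightarrow>
      src G (p x y) = rmom Y y"
    and p_lact: "x \<in> pts (space X) \<Longrightarrow> y \<in> pts (space Y) \<Longrightarrow> rmom X x = lmom Y y \<Longrightarrow>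
      g \<in> pts (arr G) \<Longrightarrow> src G g = lmom X x \<Longrightarrow> p (lact X g x) y = gcomp G g (p x y)"
    and p_ract: "x \<in> pts (space X) \<Longrightarrow> y \<in> pts (space Y) \<Longrightarrow> rmom X x = lmom Y y \<Longrightarrow>
      g \<in> pts (arr G) \<Longrightarrow> rmom Y y = trg G g \<Longrightarrow> p x (ract Y y g) = gcomp G (p x y) g"
    and p_eq_iff: "x \<in> pts (space X) \<Longrightarrow> y \<in> pts (space Y) \<Longrightarrow> rmom X x = lmom Y y \<Longrightarrow>
      x' \<in> pts (space X) \<Longrightarrow> y' \<in> pts (space Y) \<Longrightarrow> rmom X x' = lmom Y y' \<Longrightarrow>
      p x y = p x' y' \<longleftrightarrow>
      (\<exists>h\<in>pts (arr H). trg H h = rmom X x \<and> x' = ract X x h \<and> y' = lact Y (ginv H h) y)"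
begin

lemmas p_smooth = subduction_smooth[OF p_subduction]

lemma p_in: "x \<in> pts (space X) \<Longrightarrow> y \<in> pts (space Y) \<Longrightarrow> rmom X x = lmom Y y \<Longrightarrow>
    p x y \<in> pts (arr G)"
  using dsmooth_in_pts[OF p_smooth, of "(x, y)"] by simp

lemmas p_plot = dsmooth_fib_prodD[OF p_smooth X.space_diffeological Y.space_diffeological]

lemma p_lift:
  assumes "plot (arr G) m U \<gamma>" "t \<in> U"
  obtains V a b where "euclidean_domain m V" "t \<in> V" "V \<subseteq> U" "plot (space X) m V a"
    "plot (space Y) m V b" "\<And>s. s \<in> V \<Longrightarrow> rmom X (a s) = lmom Y (b s)"
    "\<And>s. s \<in> V \<Longrightarrow> \<gamma> s = p (a s) (b s)"
proof -
  from subduction_lift[OF p_subduction assms] obtain V \<beta> where V: "euclidean_domain m V" "t \<in> V" "V \<subseteq> U"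
    and \<beta>: "plot (fib_prod (space X) (space Y) (rmom X) (lmom Y)) m V \<beta>"
    and eq: "\<And>s. s \<in> V \<Longrightarrow> \<gamma> s = (\<lambda>(x, y). p x y) (\<beta> s)" by metis
  from \<beta> have "plot (space X) m V (\<lambda>s. fst (\<beta> s))" "plot (space Y) m V (\<lambda>s. snd (\<beta> s))"
    "\<And>s. s \<in> V \<Longrightarrow> rmom X (fst (\<beta> s)) = lmom Y (snd (\<beta> s))"
    by (simp_all add: plot_fib_prod[OF X.space_diffeological Y.space_diffeological])
  from that[OF V this] eq show thesis by (simp add: case_prod_beta)
qed

lemma p_onto:
  assumes "g \<in> pts (arr G)"
  obtains x y where "x \<in> pts (space X)" "y \<in> pts (space Y)" "rmom X x = lmom Y y" "p x y = g"
  using subduction_onto[OF p_subduction assms] by auto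

text \<open>
  The target of \<open>p x y\<close> is \<open>lmom X x\<close> and the target map has the smooth section \<open>ident G\<close>, so a plot
  of objects lifts through its units.
\<close>

lemma subduction_lmom: "subduction (space X) (obj G) (lmom X)"
proof (rule subductionI[OF X.lmom_smooth])
  fix a assume a: "a \<in> pts (obj G)"
  from p_onto[OF X.G.ident_in[OF a]] obtain x y where
    "x \<in> pts (space X)" "y \<in> pts (space Y)" "rmom X x = lmom Y y" "p x y = ident G a" .
  then have "lmom X x = a" using trg_p[of x y] by (simp add: X.G.trg_ident a)
  with \<open>x \<in> pts (space X)\<close> show "\<exists>x\<in>pts (space X). lmom X x = a" by blast
next
  fix m U \<gamma> t assume \<gamma>: "plot (obj G) m U \<gamma>" and t: "t \<in> U"
  from p_lift[OF X.G.ident_plot[OF \<gamma>] t] obtain V a b where V: "euclidean_domain m V" "t \<in> V" "V \<subseteq> U"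
    and ab: "plot (space X) m V a" "plot (space Y) m V b" "\<And>s. s \<in> V \<Longrightarrow> rmom X (a s) = lmom Y (b s)"
    and eq: "\<And>s. s \<in> V \<Longrightarrow> ident G (\<gamma> s) = p (a s) (b s)" by metis
  have "\<gamma> s = lmom X (a s)" if "s \<in> V" for s
  proof -
    have "\<gamma> s \<in> pts (obj G)" using plot_in_pts[OF X.G.obj_space \<gamma>] that V(3) by blast
    then have "\<gamma> s = trg G (p (a s) (b s))" using eq[OF that] X.G.trg_ident by metis
    also have "\<dots> = lmom X (a s)"
      using that ab(3) plot_in_pts[OF X.space_diffeological ab(1)] plot_in_pts[OF Y.space_diffeological ab(2)] by (simp add: trg_p)
    finally show ?thesis .
  qed
  with V ab(1) show "\<exists>V \<beta>. euclidean_domain m V \<and> t \<in> V \<and> V \<subseteq> U \<and> plot (space X) m V \<beta> \<and>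
    (\<forall>s\<in>V. \<gamma> s = lmom X (\<beta> s))" by blast
qed

text \<open>
  If \<open>g\<close> fixes \<open>x\<close>, it fixes the arrow \<open>p x y\<close> under composition. The partner \<open>y\<close> of \<open>x\<close> has to be
  supplied, since \<open>p\<close> alone does not force \<open>lmom Y\<close> to be onto.
\<close>

lemma left_action_free:
  assumes "x \<in> pts (space X)" "y \<in> pts (space Y)" "rmom X x = lmom Y y"
    and "g \<in> pts (arr G)" "src G g = lmom X x" "lact X g x = x"
  shows "g = ident G (lmom X x)"
  using p_lact[OF assms(1-5)] assms X.G.eq_ident_if_comp_eq[of g "p x y"]
  by (simp add: p_in trg_p)

text \<open>
  Inverting values makes \<open>p\<close> a pairing of the opposite bibundles in reverse order. Through this every
  fact about left actions of \<open>X\<close> has a counterpart for right actions of \<open>Y\<close>.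
\<close>

lemma dual: "perfect_pairing G H (opposite H G Y) (opposite G H X) (\<lambda>y x. ginv G (p x y))"
proof -
  interpret X': smooth_bibundle H G "opposite G H X" by (rule X.smooth_bibundle_opposite)
  interpret Y': smooth_bibundle G H "opposite H G Y" by (rule Y.smooth_bibundle_opposite)
  show ?thesis
  proof (unfold_locales, goal_cases)
    case 1
    show ?case unfolding opposite_sel
    proof (rule subductionI)
      show "dsmooth (fib_prod (space Y) (space X) (lmom Y) (rmom X)) (arr G) (\<lambda>(y, x). ginv G (p x y))"
        by (rule dsmooth_fib_prodI[OF Y.space_diffeological X.space_diffeological])
          (simp_all add: X.G.inv_in p_in X.G.inv_plot p_plot)
    next
      fix g assume g: "g \<in> pts (arr G)"
      from p_onto[OF X.G.inv_in[OF g]] obtain x y where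
        "x \<in> pts (space X)" "y \<in> pts (space Y)" "rmom X x = lmom Y y" "p x y = ginv G g" .
      then show "\<exists>c\<in>pts (fib_prod (space Y) (space X) (lmom Y) (rmom X)). (\<lambda>(y, x). ginv G (p x y)) c = g"
        by (intro bexI[of _ "(y, x)"]) (simp_all add: g X.G.inv_inv)
    next
      fix m U \<gamma> t assume \<gamma>: "plot (arr G) m U \<gamma>" and t: "t \<in> U"
      from p_lift[OF X.G.inv_plot[OF \<gamma>] t] obtain V a b where V: "euclidean_domain m V" "t \<in> V" "V \<subseteq> U"
        and ab: "plot (space X) m V a" "plot (space Y) m V b" "\<And>s. s \<in> V \<Longrightarrow> rmom X (a s) = lmom Y (b s)"
        and eq: "\<And>s. s \<in> V \<Longrightarrow> ginv G (\<gamma> s) = p (a s) (b s)" by metis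
      have "\<gamma> s = ginv G (p (a s) (b s))" if "s \<in> V" for s
        using that V(3) plot_in_pts[OF X.G.arr_space \<gamma>] eq X.G.inv_inv by (metis subsetD)
      moreover have "plot (fib_prod (space Y) (space X) (lmom Y) (rmom X)) m V (\<lambda>s. (b s, a s))"
        using ab by (simp add: plot_fib_prod[OF Y.space_diffeological X.space_diffeological])
      ultimately show "\<exists>V \<beta>. euclidean_domain m V \<and> t \<in> V \<and> V \<subseteq> U \<and>
          plot (fib_prod (space Y) (space X) (lmom Y) (rmom X)) m V \<beta> \<and>
          (\<forall>s\<in>V. \<gamma> s = (\<lambda>(y, x). ginv G (p x y)) (\<beta> s))"
        using V by (intro exI[of _ V] exI[of _ "\<lambda>s. (b s, a s)"]) simp
    qed
  next
    case (6 y x y' x')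
    then have "ginv G (p x y) = ginv G (p x' y') \<longleftrightarrow> p x y = p x' y'"
      by (metis X.G.inv_inv p_in opposite_sel)
    with 6 show ?case
      by (simp only: opposite_sel p_eq_iff) (auto simp: X.H.inv_inv)
  qed (simp_all add: p_in src_p trg_p p_lact p_ract X.G.gpd_simps X.G.inv_comp_distrib X.G.inv_inv)
qed

lemma subduction_rmom: "subduction (space Y) (obj G) (rmom Y)"
  using perfect_pairing.subduction_lmom[OF dual] by simp

end

text \<open>
  The division map of \<open>X\<close> is \<open>p x y\<close> composed with the inverse of \<open>p x' y\<close>, for any \<open>y\<close> over the common
  moment of \<open>x\<close> and \<open>x'\<close>. The pairing \<open>q\<close> makes the moment maps to the objects of \<open>H\<close> subductions, so
  that such \<open>y\<close> exist and can be chosen smoothly on small domains, and it makes \<open>H\<close> act freely on \<open>Y\<close>.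
\<close>

lemma left_principal_if_perfect_pairings:
  assumes "perfect_pairing G H X Y p" "perfect_pairing H G Y X q"
  shows "left_principal G H X"
proof -
  interpret p: perfect_pairing G H X Y p by fact
  interpret q: perfect_pairing H G Y X q by fact
  define d where "d x x' = (let y = SOME y. y \<in> pts (space Y) \<and> lmom Y y = rmom X x
    in gcomp G (p x y) (ginv G (p x' y)))" for x x'
  have src_quot: "src G (gcomp G (p x y) (ginv G (p x' y))) = lmom X x'"
    and in_quot: "gcomp G (p x y) (ginv G (p x' y)) \<in> pts (arr G)"
    if "x \<in> pts (space X)" "x' \<in> pts (space X)" "y \<in> pts (space Y)" "rmom X x = lmom Y y" "rmom X x' = lmom Y y"
    for x x' y
    using that by (simp_all add: p.p_in p.X.G.gpd_simps p.src_p p.trg_p)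
  have quot_lact: "gcomp G (p (lact X g x') y) (ginv G (p x' y)) = g"
    if "g \<in> pts (arr G)" "x' \<in> pts (space X)" "y \<in> pts (space Y)" "src G g = lmom X x'" "rmom X x' = lmom Y y"
    for g x' y
    using that p.X.G.comp_assoc[of g "p x' y" "ginv G (p x' y)"] p.X.G.comp_ident[of g]
    by (simp add: p.p_in p.X.G.gpd_simps p.src_p p.trg_p p.p_lact)
  have lact_quot: "lact X (gcomp G (p x y) (ginv G (p x' y))) x' = x"
    if 1: "x \<in> pts (space X)" "x' \<in> pts (space X)" "y \<in> pts (space Y)" "rmom X x = lmom Y y" "rmom X x' = lmom Y y"
    for x x' y
  proof -
    let ?g = "gcomp G (p x y) (ginv G (p x' y))"
    note g = src_quot[OF 1] in_quot[OF 1]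
    have "p (lact X ?g x') y = p x y"
      using 1 g by (simp add: p.p_lact p.X.G.comp_inv_cancel p.p_in p.src_p)
    moreover have gx: "lact X ?g x' \<in> pts (space X)" "rmom X (lact X ?g x') = lmom Y y"
      using 1 g by (simp_all add: p.X.bib_simps)
    ultimately obtain h where h: "h \<in> pts (arr H)" "trg H h = lmom Y y" "x = ract X (lact X ?g x') h"
      "y = lact Y (ginv H h) y"
      using p.p_eq_iff[of "lact X ?g x'" y x y] 1 by auto
    obtain x'' where "x'' \<in> pts (space X)" "lmom X x'' = rmom Y y"
      using subduction_onto[OF p.subduction_lmom p.Y.rmom_in[OF 1(3)]] by blast
    \<comment> \<open>The inverse of \<open>h\<close> fixes \<open>y\<close>, and \<open>H\<close> acts freely on \<open>Y\<close> by the second pairing.\<close>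
    then have "ginv H h = ident H (lmom Y y)"
      using q.left_action_free[of y x'' "ginv H h"] h 1 by (simp add: p.X.H.gpd_simps)
    then have "h = ident H (lmom Y y)"
      using p.X.H.inv_inv[OF h(1)] p.X.H.inv_of_ident[OF p.Y.lmom_in[OF 1(3)]] by simp
    with h(3) show ?thesis using p.X.ract_ident[OF gx(1)] gx(2) by simp
  qed
  have d_eq: "d x x' = gcomp G (p x y) (ginv G (p x' y))"
    if 1: "x \<in> pts (space X)" "x' \<in> pts (space X)" "y \<in> pts (space Y)" "rmom X x = lmom Y y" "rmom X x' = lmom Y y"
    for x x' y
  proof -
    define y' where "y' = (SOME y. y \<in> pts (space Y) \<and> lmom Y y = rmom X x)"
    have y': "y' \<in> pts (space Y)" "lmom Y y' = rmom X x"
      using someI[of "\<lambda>y. y \<in> pts (space Y) \<and> lmom Y y = rmom X x" y] 1 unfolding y'_def by simp_all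
    \<comment> \<open>Both \<open>y\<close> and the chosen \<open>y'\<close> recover the same arrow: \<open>x = g x'\<close> for the arrow \<open>g\<close> obtained from
      \<open>y\<close>, and dividing \<open>g x'\<close> by \<open>x'\<close> with the help of \<open>y'\<close> returns \<open>g\<close>.\<close>
    let ?g = "gcomp G (p x y) (ginv G (p x' y))"
    have "gcomp G (p (lact X ?g x') y') (ginv G (p x' y')) = ?g"
      by (rule quot_lact) (use 1 y' src_quot[OF 1] in_quot[OF 1] in simp_all)
    then show ?thesis
      by (simp add: d_def y'_def[symmetric] lact_quot[OF 1])
  qed
  have ex_y: "\<exists>y\<in>pts (space Y). lmom Y y = rmom X x" if "x \<in> pts (space X)" for x
    using subduction_onto[OF q.subduction_lmom p.X.rmom_in[OF that]] .
  have "left_pre_principal G H X"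
  proof (rule p.X.left_pre_principalI[of d])
    show "dsmooth (fib_prod (space X) (space X) (rmom X) (rmom X)) (arr G) (\<lambda>(x, y). d x y)"
    proof (rule dsmooth_fib_prodI[OF p.X.space_diffeological p.X.space_diffeological])
      fix x x' assume "x \<in> pts (space X)" "x' \<in> pts (space X)" "rmom X x = rmom X x'"
      then show "d x x' \<in> pts (arr G)" using ex_y[of x] d_eq in_quot by metis
    next
      fix m U a b
      assume a: "plot (space X) m U a" and b: "plot (space X) m U b"
        and ab: "\<And>t. t \<in> U \<Longrightarrow> rmom X (a t) = rmom X (b t)"
      show "plot (arr G) m U (\<lambda>t. d (a t) (b t))"
      proof (rule plot_locally[OF p.X.G.arr_space plot_domain[OF p.X.space_diffeological a]])
        fix t assume "t \<in> U"
        from subduction_lift[OF q.subduction_lmom p.X.rmom_plot[OF a] this] obtain V c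
          where V: "euclidean_domain m V" "t \<in> V" "V \<subseteq> U" and c: "plot (space Y) m V c"
            and ac: "\<And>s. s \<in> V \<Longrightarrow> rmom X (a s) = lmom Y (c s)" by metis
        have bc: "rmom X (b s) = lmom Y (c s)" if "s \<in> V" for s
          using that V(3) ab ac by (metis subsetD)
        have a': "plot (space X) m V a" and b': "plot (space X) m V b"
          using plot_restrict[OF p.X.space_diffeological a V(1,3)] plot_restrict[OF p.X.space_diffeological b V(1,3)] .
        note in_pts = plot_in_pts[OF p.X.space_diffeological a'] plot_in_pts[OF p.X.space_diffeological b']
          plot_in_pts[OF p.Y.space_diffeological c]
        have "plot (arr G) m V (\<lambda>s. gcomp G (p (a s) (c s)) (ginv G (p (b s) (c s))))"
          by (intro p.X.G.comp_plot p.p_plot p.X.G.inv_plot a' b' c)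
            (simp_all add: ac bc in_pts p.p_in p.src_p p.X.G.gpd_simps)
        then have "plot (arr G) m V (\<lambda>s. d (a s) (b s))"
          by (rule plot_cong[OF p.X.G.arr_space]) (simp add: ac bc in_pts d_eq)
        with V show "\<exists>V. euclidean_domain m V \<and> t \<in> V \<and> V \<subseteq> U \<and> plot (arr G) m V (\<lambda>t. d (a t) (b t))"
          by blast
      qed
    qed
  next
    fix x x' assume x: "x \<in> pts (space X)" "x' \<in> pts (space X)" "rmom X x = rmom X x'"
    from ex_y[OF x(1)] obtain y where y: "y \<in> pts (space Y)" "rmom X x = lmom Y y" by metis
    then show "src G (d x x') = lmom X x'" "lact X (d x x') x' = x"
      using x by (simp_all add: d_eq src_quot lact_quot)
  next
    fix g x assume g: "g \<in> pts (arr G)" "x \<in> pts (space X)" "src G g = lmom X x"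
    from ex_y[OF g(2)] obtain y where y: "y \<in> pts (space Y)" "rmom X x = lmom Y y" by metis
    then show "d (lact X g x) x = g"
      using g d_eq[of "lact X g x" x y] by (simp add: quot_lact p.X.bib_simps)
  qed
  then show ?thesis
    using q.subduction_rmom by (simp add: left_principal_def left_subductive_def)
qed

text \<open>
  The actions of \<open>Y\<close> matter only on the arrow spaces. This allows \<open>X\<close> to take the place of the
  opposite of its opposite.
\<close>

lemma (in perfect_pairing) cong_right:
  assumes "smooth_bibundle H G Y'" "space Y' = space Y" "lmom Y' = lmom Y" "rmom Y' = rmom Y"
    and lact: "\<And>h y. h \<in> pts (arr H) \<Longrightarrow> lact Y' h y = lact Y h y"
    and ract: "\<And>y g. g \<in> pts (arr G) \<Longrightarrow> ract Y' y g = ract Y y g"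
  shows "perfect_pairing G H X Y' p"
proof -
  interpret Y': smooth_bibundle H G Y' by fact
  show ?thesis
    by unfold_locales
      (simp_all add: assms(2-4) lact ract p_subduction src_p trg_p p_lact p_ract p_eq_iff X.H.inv_in cong: bex_cong)
qed

text \<open>
  The pairing is the division map \<open>d\<close> of the left action. If \<open>d x y = d x' y'\<close>, then \<open>y\<close> and \<open>y'\<close> have
  the same left moment, so \<open>y' = y h\<close> by division for the right action, and applying the common arrow
  gives \<open>x' = x h\<close>. An arrow \<open>g\<close> is \<open>d (g y) y\<close> for any \<open>y\<close> over its source, and \<open>y\<close> can be chosen
  smoothly because \<open>lmom X\<close> is a subduction.
\<close>

lemma (in smooth_bibundle) perfect_pairing_opposite:
  assumes "left_principal G H X" "left_principal H G (opposite G H X)"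
  shows "\<exists>p. perfect_pairing G H X (opposite G H X) p"
proof -
  interpret X': smooth_bibundle H G "opposite G H X" by (rule smooth_bibundle_opposite)
  from assms(1) have "left_pre_principal G H X" by (simp add: left_principal_def)
  then obtain d where
    d: "dsmooth (fib_prod (space X) (space X) (rmom X) (rmom X)) (arr G) (\<lambda>(x, y). d x y)"
    and d_in: "\<And>x y. x \<in> pts (space X) \<Longrightarrow> y \<in> pts (space X) \<Longrightarrow> rmom X x = rmom X y \<Longrightarrow>
      d x y \<in> pts (arr G)"
    and src_d: "\<And>x y. x \<in> pts (space X) \<Longrightarrow> y \<in> pts (space X) \<Longrightarrow> rmom X x = rmom X y \<Longrightarrow>
      src G (d x y) = lmom X y"
    and d_lact: "\<And>x y. x \<in> pts (space X) \<Longrightarrow> y \<in> pts (space X) \<Longrightarrow> rmom X x = rmom X y \<Longrightarrow>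
      lact X (d x y) y = x"
    and d_eqI': "\<And>g y. g \<in> pts (arr G) \<Longrightarrow> y \<in> pts (space X) \<Longrightarrow> src G g = lmom X y \<Longrightarrow>
      d (lact X g y) y = g"
    by (rule left_pre_principalE) (rule that; assumption)
  have d_eqI: "d x y = g" if "g \<in> pts (arr G)" "y \<in> pts (space X)" "src G g = lmom X y" "lact X g y = x"
    for g x y
    using d_eqI'[OF that(1-3)] that(4) by simp
  have trg_d: "trg G (d x y) = lmom X x"
    if "x \<in> pts (space X)" "y \<in> pts (space X)" "rmom X x = rmom X y" for x y
    using lmom_lact[OF d_in[OF that] that(2) src_d[OF that]] d_lact[OF that] by simp
  have right_quot: "\<exists>h\<in>pts (arr H). trg H h = rmom X y \<and> y' = ract X y h"
    if y: "y \<in> pts (space X)" "y' \<in> pts (space X)" "lmom X y = lmom X y'" for y y'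
  proof -
    from assms(2) have "left_pre_principal H G (opposite G H X)" by (simp add: left_principal_def)
    then obtain e where
      "\<And>x y. x \<in> pts (space X) \<Longrightarrow> y \<in> pts (space X) \<Longrightarrow> lmom X x = lmom X y \<Longrightarrow> e x y \<in> pts (arr H)"
      "\<And>x y. x \<in> pts (space X) \<Longrightarrow> y \<in> pts (space X) \<Longrightarrow> lmom X x = lmom X y \<Longrightarrow>
        src H (e x y) = rmom X y"
      "\<And>x y. x \<in> pts (space X) \<Longrightarrow> y \<in> pts (space X) \<Longrightarrow> lmom X x = lmom X y \<Longrightarrow>
        ract X y (ginv H (e x y)) = x"
      by (rule X'.left_pre_principalE) (rule that; simp)
    with y show ?thesis by (intro bexI[of _ "ginv H (e y' y)"]) (simp_all add: H.gpd_simps)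
  qed
  have "perfect_pairing G H X (opposite G H X) d"
  proof (unfold_locales, goal_cases)
    case 1
    show ?case unfolding opposite_sel
    proof (rule subductionI[OF d])
      have l: "subduction (space X) (obj G) (lmom X)"
        using assms(2) by (simp add: left_principal_def left_subductive_def)
      {
        fix g assume g: "g \<in> pts (arr G)"
        from subduction_onto[OF l G.src_in[OF g]] obtain y where
          "y \<in> pts (space X)" "lmom X y = src G g" by blast
        with g show "\<exists>c\<in>pts (fib_prod (space X) (space X) (rmom X) (rmom X)). (\<lambda>(x, y). d x y) c = g"
          by (intro bexI[of _ "(lact X g y, y)"]) (simp_all add: d_eqI' bib_simps)
      next
        fix m U \<gamma> t assume \<gamma>: "plot (arr G) m U \<gamma>" and t: "t \<in> U"
        from subduction_lift[OF l G.src_plot[OF \<gamma>] t] obtain V b where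
          V: "euclidean_domain m V" "t \<in> V" "V \<subseteq> U" and b: "plot (space X) m V b"
          and eq: "\<And>s. s \<in> V \<Longrightarrow> src G (\<gamma> s) = lmom X (b s)" by metis
        have \<gamma>': "plot (arr G) m V \<gamma>" by (rule plot_restrict[OF G.arr_space \<gamma> V(1,3)])
        note in_pts = plot_in_pts[OF G.arr_space \<gamma>'] plot_in_pts[OF space_diffeological b]
        have "plot (fib_prod (space X) (space X) (rmom X) (rmom X)) m V (\<lambda>s. (lact X (\<gamma> s) (b s), b s))"
          using lact_plot[OF \<gamma>' b eq] b
          by (simp add: plot_fib_prod[OF space_diffeological space_diffeological] rmom_lact eq in_pts)
        moreover have "\<forall>s\<in>V. \<gamma> s = (\<lambda>(x, y). d x y) (lact X (\<gamma> s) (b s), b s)"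
          by (simp add: d_eqI' eq in_pts)
        ultimately show "\<exists>V \<beta>. euclidean_domain m V \<and> t \<in> V \<and> V \<subseteq> U \<and>
          plot (fib_prod (space X) (space X) (rmom X) (rmom X)) m V \<beta> \<and> (\<forall>s\<in>V. \<gamma> s = (\<lambda>(x, y). d x y) (\<beta> s))"
          using V by (intro exI[of _ V] exI[of _ "\<lambda>s. (lact X (\<gamma> s) (b s), b s)"]) simp
      }
    qed
  next
    case (2 x y)
    then show ?case by (simp add: trg_d)
  next
    case (3 x y)
    then show ?case by (simp add: src_d)
  next
    case (4 x y g)
    then show ?case
      by (intro d_eqI) (simp_all add: d_in src_d trg_d G.gpd_simps lact_lact[symmetric] d_lact)
  next
    case (5 x y g)
    then have 5: "x \<in> pts (space X)" "y \<in> pts (space X)" "rmom X x = rmom X y" "g \<in> pts (arr G)" "lmom X y = trg G g"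
      by simp_all
    have "lact X (gcomp G (d x y) g) (lact X (ginv G g) y) = lact X (d x y) (lact X g (lact X (ginv G g) y))"
      using 5 by (intro lact_lact[symmetric]) (simp_all add: G.gpd_simps bib_simps src_d d_in)
    also have "\<dots> = x"
      using 5 lact_inv_lact[of "ginv G g" y] by (simp add: G.gpd_simps G.inv_inv d_lact)
    finally show ?case
      using 5 unfolding opposite_sel
      by (intro d_eqI) (simp_all add: G.gpd_simps bib_simps src_d d_in)
  next
    case (6 x y x' y')
    then have x: "x \<in> pts (space X)" "y \<in> pts (space X)" "rmom X x = rmom X y"
      and x': "x' \<in> pts (space X)" "y' \<in> pts (space X)" "rmom X x' = rmom X y'" by simp_all
    show ?case unfolding opposite_sel
    proof
      assume eq: "d x y = d x' y'"
      then have "lmom X y = lmom X y'" using src_d[OF x] src_d[OF x'] by simp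
      with right_quot[OF x(2) x'(2)] obtain h where h: "h \<in> pts (arr H)" "trg H h = rmom X y" "y' = ract X y h"
        by blast
      have "x' = lact X (d x y) (ract X y h)" using d_lact[OF x'] eq h(3) by simp
      also have "\<dots> = ract X x h"
        using ract_lact[OF d_in[OF x] x(2) h(1) src_d[OF x]] h(2) d_lact[OF x] by simp
      finally show "\<exists>h\<in>pts (arr H). trg H h = rmom X x \<and> x' = ract X x h \<and> y' = ract X y (ginv H (ginv H h))"
        using h x by (intro bexI[of _ h]) (simp_all add: H.inv_inv)
    next
      assume "\<exists>h\<in>pts (arr H). trg H h = rmom X x \<and> x' = ract X x h \<and> y' = ract X y (ginv H (ginv H h))"
      then obtain h where h: "h \<in> pts (arr H)" "trg H h = rmom X y" "x' = ract X x h" "y' = ract X y h"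
        using x by (auto simp: H.inv_inv)
      have "lact X (d x y) (ract X y h) = ract X x h"
        using ract_lact[OF d_in[OF x] x(2) h(1) src_d[OF x]] h(2) d_lact[OF x] by simp
      then show "d x y = d x' y'"
        using x h by (intro d_eqI[symmetric]) (simp_all add: d_in src_d bib_simps)
    qed
  qed
  then show ?thesis by blast
qed

section \<open>Pairings and balanced tensor products\<close>

locale composable = X: smooth_bibundle G H X + Y: smooth_bibundle H K Y
  for G :: "('g0, 'g) dgroupoid" and H :: "('h0, 'h) dgroupoid" and K :: "('k0, 'k) dgroupoid"
    and X :: "('g0, 'g, 'h0, 'h, 'x) bibundle" and Y :: "('h0, 'h, 'k0, 'k, 'y) bibundle"
begin

abbreviation "pairs \<equiv> fib_prod (space X) (space Y) (rmom X) (lmom Y)"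
abbreviation "cls x y \<equiv> balanced_rel H X Y `` {(x, y)}"

lemma pairs_diffeological: "diffeological_space pairs"
  by (rule diffeological_space_fib_prod[OF X.space_diffeological Y.space_diffeological])

lemma balanced_rel_iff:
  "((x, y), (x', y')) \<in> balanced_rel H X Y \<longleftrightarrow> x \<in> pts (space X) \<and> y \<in> pts (space Y) \<and> rmom X x = lmom Y y \<and>
    (\<exists>h\<in>pts (arr H). trg H h = rmom X x \<and> x' = ract X x h \<and> y' = lact Y (ginv H h) y)"
  unfolding balanced_rel_def by auto

lemma balanced_rel_in:
  "((x, y), (x', y')) \<in> balanced_rel H X Y \<Longrightarrow>
    x' \<in> pts (space X) \<and> y' \<in> pts (space Y) \<and> rmom X x' = lmom Y y'"
  by (auto simp: balanced_rel_iff X.bib_simps Y.bib_simps X.H.gpd_simps)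

lemma equiv_balanced_rel: "equiv (pts pairs) (balanced_rel H X Y)"
proof (rule equivI)
  show "balanced_rel H X Y \<subseteq> pts pairs \<times> pts pairs"
  proof (rule subrelI)
    fix c c' assume "(c, c') \<in> balanced_rel H X Y"
    then show "(c, c') \<in> pts pairs \<times> pts pairs"
      using balanced_rel_in[of "fst c" "snd c" "fst c'" "snd c'"]
        balanced_rel_iff[of "fst c" "snd c" "fst c'" "snd c'"] by (simp add: case_prod_beta)
  qed
  show "refl_on (pts pairs) (balanced_rel H X Y)"
  proof (rule refl_onI)
    fix c assume "c \<in> pts pairs"
    then obtain x y where "c = (x, y)" "x \<in> pts (space X)" "y \<in> pts (space Y)" "rmom X x = lmom Y y" by auto
    then show "(c, c) \<in> balanced_rel H X Y"
      using X.ract_ident[of x] Y.lact_ident[of y]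
      by (auto simp: balanced_rel_iff X.H.gpd_simps X.bib_simps Y.bib_simps X.H.inv_of_ident
          intro!: bexI[of _ "ident H (lmom Y y)"])
  qed
  show "sym (balanced_rel H X Y)"
  proof (rule symI, clarify)
    fix x y x' y' assume r: "((x, y), (x', y')) \<in> balanced_rel H X Y"
    then obtain h where h: "x \<in> pts (space X)" "y \<in> pts (space Y)" "rmom X x = lmom Y y"
      "h \<in> pts (arr H)" "trg H h = rmom X x" "x' = ract X x h" "y' = lact Y (ginv H h) y"
      unfolding balanced_rel_iff by blast
    have "x = ract X x' (ginv H h)" "y = lact Y (ginv H (ginv H h)) y'"
      using h X.ract_ract_inv[of x h] Y.lact_inv_lact[of "ginv H h" y] by (simp_all add: X.H.gpd_simps)
    moreover have "ginv H h \<in> pts (arr H)" "trg H (ginv H h) = rmom X x'"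
      using h by (simp_all add: X.H.gpd_simps X.rmom_ract)
    ultimately show "((x', y'), (x, y)) \<in> balanced_rel H X Y"
      using balanced_rel_in[OF r] unfolding balanced_rel_iff by blast
  qed
  show "trans (balanced_rel H X Y)"
  proof (rule transI, clarify)
    fix x y x' y' x'' y'' assume "((x, y), (x', y')) \<in> balanced_rel H X Y" "((x', y'), (x'', y'')) \<in> balanced_rel H X Y"
    then obtain h k where h: "x \<in> pts (space X)" "y \<in> pts (space Y)" "rmom X x = lmom Y y"
      "h \<in> pts (arr H)" "trg H h = rmom X x" "x' = ract X x h" "y' = lact Y (ginv H h) y"
      and k: "k \<in> pts (arr H)" "trg H k = rmom X x'" "x'' = ract X x' k" "y'' = lact Y (ginv H k) y'"
      unfolding balanced_rel_iff by blast
    have "src H h = trg H k" using h k by (simp add: X.rmom_ract)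
    with h k show "((x, y), (x'', y'')) \<in> balanced_rel H X Y"
      unfolding balanced_rel_iff
      by (intro conjI bexI[of _ "gcomp H h k"])
        (simp_all add: X.ract_ract Y.lact_lact X.H.gpd_simps X.H.inv_comp_distrib)
  qed
qed

lemma space_tensor: "space (tensor H X Y) = quot_space pairs (balanced_rel H X Y)"
  by (simp add: tensor_def)

lemma pts_tensor: "pts (space (tensor H X Y)) = pts pairs // balanced_rel H X Y"
  by (simp add: space_tensor quot_space_def)

lemma cls_in:
  "x \<in> pts (space X) \<Longrightarrow> y \<in> pts (space Y) \<Longrightarrow> rmom X x = lmom Y y \<Longrightarrow> cls x y \<in> pts (space (tensor H X Y))"
  unfolding pts_tensor by (rule quotientI) simp

lemma tensor_cases:
  assumes "c \<in> pts (space (tensor H X Y))"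
  obtains x y where "x \<in> pts (space X)" "y \<in> pts (space Y)" "rmom X x = lmom Y y" "c = cls x y"
  using assms unfolding pts_tensor by (auto elim!: quotientE)

text \<open>
  A function on composable pairs that is invariant under the balancing can be evaluated on a class at
  any representative; all structure maps of the tensor product are of this form.
\<close>

lemma the_elem_cls:
  assumes "x \<in> pts (space X)" "y \<in> pts (space Y)" "rmom X x = lmom Y y"
    and "\<And>h. h \<in> pts (arr H) \<Longrightarrow> trg H h = rmom X x \<Longrightarrow> f (ract X x h) (lact Y (ginv H h) y) = f x y"
  shows "the_elem ((\<lambda>(x, y). f x y) ` cls x y) = f x y"
proof -
  have "(\<lambda>(x, y). f x y) c = (\<lambda>(x, y). f x y) (x, y)" if "c \<in> cls x y" for c
    using that assms(4) by (cases c) (auto simp: balanced_rel_iff)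
  moreover have "(x, y) \<in> cls x y"
    using equiv_class_self[OF equiv_balanced_rel, of "(x, y)"] assms by simp
  ultimately show ?thesis
    using the_elem_image_unique[where A = "cls x y" and f = "\<lambda>(x, y). f x y" and a = "f x y"] by auto
qed

lemma tensor_cls:
  assumes "x \<in> pts (space X)" "y \<in> pts (space Y)" "rmom X x = lmom Y y"
  shows lmom_tensor: "lmom (tensor H X Y) (cls x y) = lmom X x"
    and rmom_tensor: "rmom (tensor H X Y) (cls x y) = rmom Y y"
    and lact_tensor: "g \<in> pts (arr G) \<Longrightarrow> src G g = lmom X x \<Longrightarrow>
      lact (tensor H X Y) g (cls x y) = cls (lact X g x) y"
    and ract_tensor: "k \<in> pts (arr K) \<Longrightarrow> trg K k = rmom Y y \<Longrightarrow>
      ract (tensor H X Y) (cls x y) k = cls x (ract Y y k)"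
proof -
  show "lmom (tensor H X Y) (cls x y) = lmom X x"
    unfolding tensor_def bibundle.simps
    by (rule the_elem_cls[OF assms]) (use assms in \<open>simp add: X.bib_simps\<close>)
  show "rmom (tensor H X Y) (cls x y) = rmom Y y"
    unfolding tensor_def bibundle.simps
    by (rule the_elem_cls[OF assms]) (use assms in \<open>simp add: Y.bib_simps X.H.gpd_simps\<close>)
  show "lact (tensor H X Y) g (cls x y) = cls (lact X g x) y"
    if g: "g \<in> pts (arr G)" "src G g = lmom X x"
    unfolding tensor_def bibundle.simps
  proof (rule the_elem_cls[OF assms])
    fix h assume h: "h \<in> pts (arr H)" "trg H h = rmom X x"
    have "((lact X g x, y), (lact X g (ract X x h), lact Y (ginv H h) y)) \<in> balanced_rel H X Y"
      using assms g h unfolding balanced_rel_iff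
      by (intro conjI bexI[of _ h]) (simp_all add: X.bib_simps X.ract_lact)
    then show "cls (lact X g (ract X x h)) (lact Y (ginv H h) y) = cls (lact X g x) y"
      by (rule equiv_class_eq[OF equiv_balanced_rel, symmetric])
  qed
  show "ract (tensor H X Y) (cls x y) k = cls x (ract Y y k)"
    if k: "k \<in> pts (arr K)" "trg K k = rmom Y y"
    unfolding tensor_def bibundle.simps
  proof (rule the_elem_cls[OF assms])
    fix h assume h: "h \<in> pts (arr H)" "trg H h = rmom X x"
    have "((x, ract Y y k), (ract X x h, ract Y (lact Y (ginv H h) y) k)) \<in> balanced_rel H X Y"
      using assms k h unfolding balanced_rel_iff
      by (intro conjI bexI[of _ h]) (simp_all add: Y.bib_simps X.H.gpd_simps Y.ract_lact)
    then show "cls (ract X x h) (ract Y (lact Y (ginv H h) y) k) = cls x (ract Y y k)"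
      by (rule equiv_class_eq[OF equiv_balanced_rel, symmetric])
  qed
qed

end

lemma id_bibundle_sel [simp]:
  "space (id_bibundle G) = arr G" "lmom (id_bibundle G) = trg G" "rmom (id_bibundle G) = src G"
  "lact (id_bibundle G) = gcomp G" "ract (id_bibundle G) = gcomp G"
  by (simp_all add: id_bibundle_def)

lemma perfect_pairing_if_tensor_iso:
  assumes "smooth_bibundle G H X" "smooth_bibundle H G Y"
    and "biequivariant G G (tensor H X Y) (id_bibundle G) \<phi>"
    and "diffeomorphism (space (tensor H X Y)) (space (id_bibundle G)) \<phi>"
  shows "perfect_pairing G H X Y (\<lambda>x y. \<phi> (balanced_rel H X Y `` {(x, y)}))"
proof -
  interpret X: smooth_bibundle G H X by fact
  interpret Y: smooth_bibundle H G Y by fact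
  interpret composable G H G X Y ..
  have mom: "\<And>c. c \<in> pts (space (tensor H X Y)) \<Longrightarrow>
      trg G (\<phi> c) = lmom (tensor H X Y) c \<and> src G (\<phi> c) = rmom (tensor H X Y) c"
    and lact: "\<And>c g. c \<in> pts (space (tensor H X Y)) \<Longrightarrow> g \<in> pts (arr G) \<Longrightarrow> src G g = lmom (tensor H X Y) c \<Longrightarrow>
      \<phi> (lact (tensor H X Y) g c) = gcomp G g (\<phi> c)"
    and ract: "\<And>c g. c \<in> pts (space (tensor H X Y)) \<Longrightarrow> g \<in> pts (arr G) \<Longrightarrow> rmom (tensor H X Y) c = trg G g \<Longrightarrow>
      \<phi> (ract (tensor H X Y) c g) = gcomp G (\<phi> c) g"
    using assms(3) by (simp_all add: biequivariant_def)
  have diffeo: "diffeomorphism (quot_space pairs (balanced_rel H X Y)) (arr G) \<phi>"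
    using assms(4) by (simp add: space_tensor)
  then have inj: "inj_on \<phi> (pts (space (tensor H X Y)))"
    by (simp add: diffeomorphism_def bij_betw_def space_tensor)
  show ?thesis
  proof (unfold_locales, goal_cases)
    case 1
    have "(\<lambda>(x, y). \<phi> (cls x y)) = (\<lambda>c. \<phi> (balanced_rel H X Y `` {c}))" by auto
    then show ?case
      using subduction_of_diffeomorphism_quot_space[OF pairs_diffeological X.G.arr_space diffeo] by simp
  next
    case (2 x y) then show ?case using mom[OF cls_in] by (simp add: tensor_cls)
  next
    case (3 x y) then show ?case using mom[OF cls_in] by (simp add: tensor_cls)
  next
    case (4 x y g) then show ?case using lact[OF cls_in, of x y g] by (simp add: tensor_cls)
  next
    case (5 x y g) then show ?case using ract[OF cls_in, of x y g] by (simp add: tensor_cls)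
  next
    case (6 x y x' y')
    then have "\<phi> (cls x y) = \<phi> (cls x' y') \<longleftrightarrow> cls x y = cls x' y'"
      using inj_on_eq_iff[OF inj cls_in cls_in] by simp
    also have "\<dots> \<longleftrightarrow> ((x, y), (x', y')) \<in> balanced_rel H X Y"
      using 6 by (intro eq_equiv_class_iff[OF equiv_balanced_rel]) simp_all
    finally show ?case using 6 by (simp add: balanced_rel_iff)
  qed
qed

lemma (in perfect_pairing) tensor_iso:
  "\<exists>\<phi>. biequivariant G G (tensor H X Y) (id_bibundle G) \<phi> \<and>
    diffeomorphism (space (tensor H X Y)) (space (id_bibundle G)) \<phi>"
proof -
  interpret composable G H G X Y ..
  define \<phi> where "\<phi> c = the_elem ((\<lambda>(x, y). p x y) ` c)" for c
  have \<phi>: "\<phi> (cls x y) = p x y"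
    if "x \<in> pts (space X)" "y \<in> pts (space Y)" "rmom X x = lmom Y y" for x y
    unfolding \<phi>_def
  proof (rule the_elem_cls[OF that])
    fix h assume "h \<in> pts (arr H)" "trg H h = rmom X x"
    with that show "p (ract X x h) (lact Y (ginv H h) y) = p x y"
      by (intro p_eq_iff[THEN iffD2, symmetric] bexI[of _ h])
        (simp_all add: X.bib_simps Y.bib_simps X.H.gpd_simps)
  qed
  have diffeo: "diffeomorphism (quot_space pairs (balanced_rel H X Y)) (arr G) \<phi>"
    by (rule diffeomorphism_quot_spaceI[OF pairs_diffeological X.G.arr_space p_subduction equiv_balanced_rel])
      (auto simp: \<phi> balanced_rel_iff p_eq_iff)
  have "biequivariant G G (tensor H X Y) (id_bibundle G) \<phi>"
    unfolding biequivariant_def id_bibundle_sel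
  proof (intro conjI ballI impI)
    show "dsmooth (space (tensor H X Y)) (arr G) \<phi>"
      using diffeo by (simp add: diffeomorphism_def space_tensor)
  next
    fix c assume "c \<in> pts (space (tensor H X Y))"
    then show "trg G (\<phi> c) = lmom (tensor H X Y) c" "src G (\<phi> c) = rmom (tensor H X Y) c"
      by (auto elim!: tensor_cases simp: \<phi> tensor_cls trg_p src_p)
  next
    fix c g assume c: "c \<in> pts (space (tensor H X Y))" and g: "g \<in> pts (arr G)"
    from c obtain x y where xy: "x \<in> pts (space X)" "y \<in> pts (space Y)" "rmom X x = lmom Y y" "c = cls x y"
      by (rule tensor_cases)
    show "\<phi> (lact (tensor H X Y) g c) = gcomp G g (\<phi> c)" if "src G g = lmom (tensor H X Y) c"
      using that xy g by (simp add: tensor_cls \<phi> p_lact X.bib_simps)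
    show "\<phi> (ract (tensor H X Y) c g) = gcomp G (\<phi> c) g" if "rmom (tensor H X Y) c = trg G g"
      using that xy g by (simp add: tensor_cls \<phi> p_ract Y.bib_simps)
  qed
  with diffeo show ?thesis by (auto simp: space_tensor)
qed

section \<open>Weak invertibility and biprincipality\<close>

text \<open>
  The left half uses the pairings themselves and the right half their duals, which pair the opposites
  of \<open>X\<close> and \<open>Y\<close>.
\<close>

lemma (in smooth_bibundle) biprincipal_if_weak_inverse:
  assumes "weak_inverse G H X Y"
  shows "biprincipal G H X"
proof -
  interpret Y: smooth_bibundle H G Y
    using assms by unfold_locales (simp add: weak_inverse_def)
  from assms obtain p q where pq: "perfect_pairing G H X Y p" "perfect_pairing H G Y X q"
    unfolding weak_inverse_def
    by (metis perfect_pairing_if_tensor_iso smooth_bibundle_axioms Y.smooth_bibundle_axioms)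
  have "left_principal G H X"
    by (rule left_principal_if_perfect_pairings[OF pq])
  moreover have "left_principal H G (opposite G H X)"
    by (rule left_principal_if_perfect_pairings[OF pq(2)[THEN perfect_pairing.dual] pq(1)[THEN perfect_pairing.dual]])
  ultimately show ?thesis by (simp add: biprincipal_iff_opposite)
qed

lemma (in smooth_bibundle) weak_inverse_opposite:
  assumes "biprincipal G H X"
  shows "weak_inverse G H X (opposite G H X)"
proof -
  interpret X': smooth_bibundle H G "opposite G H X" by (rule smooth_bibundle_opposite)
  have lr: "left_principal G H X" "left_principal H G (opposite G H X)"
    using assms by (simp_all add: biprincipal_iff_opposite)
  obtain p where p: "perfect_pairing G H X (opposite G H X) p"
    using perfect_pairing_opposite[OF lr] ..
  obtain q where "perfect_pairing H G (opposite G H X) (opposite H G (opposite G H X)) q"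
    using X'.perfect_pairing_opposite[OF lr(2) left_principal_opposite_opposite[OF lr(1)]] ..
  then have "perfect_pairing H G (opposite G H X) X q"
    by (rule perfect_pairing.cong_right) (simp_all add: smooth_bibundle_axioms opposite_opposite G.inv_inv H.inv_inv)
  then show ?thesis
    unfolding weak_inverse_def
    using diffeological_bibundle_opposite
      perfect_pairing.tensor_iso[OF p] perfect_pairing.tensor_iso[of H G "opposite G H X" X q]
    by (intro conjI)
qed

theorem theorem5p28:
  fixes G :: "('g0, 'g) dgroupoid" and H :: "('h0, 'h) dgroupoid"
  assumes "diffeological_groupoid G" and "diffeological_groupoid H"
  shows "(\<forall>X :: ('g0, 'g, 'h0, 'h, 'x) bibundle. diffeological_bibundle G H X \<longrightarrow>
            (weakly_invertible TYPE('x) G H X \<longleftrightarrow> biprincipal G H X) \<and>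
            (weakly_invertible TYPE('y) G H X \<longrightarrow> biprincipal G H X)) \<and>
         (morita_equivalent TYPE('x) G H \<longleftrightarrow>
            (\<exists>X :: ('g0, 'g, 'h0, 'h, 'x) bibundle.
               diffeological_bibundle G H X \<and> weakly_invertible TYPE('x) G H X))"
proof -
  have main: "(weakly_invertible TYPE('x) G H X \<longleftrightarrow> biprincipal G H X) \<and>
      (weakly_invertible TYPE('y) G H X \<longrightarrow> biprincipal G H X)"
    if "diffeological_bibundle G H X" for X :: "('g0, 'g, 'h0, 'h, 'x) bibundle"
  proof -
    interpret smooth_bibundle G H X
      using assms that by unfold_locales
    have "weakly_invertible TYPE('x) G H X \<Longrightarrow> biprincipal G H X"
      and "weakly_invertible TYPE('y) G H X \<Longrightarrow> biprincipal G H X"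
      unfolding weakly_invertible_def by (elim exE, rule biprincipal_if_weak_inverse, assumption)+
    moreover have "biprincipal G H X \<Longrightarrow> weakly_invertible TYPE('x) G H X"
      unfolding weakly_invertible_def by (rule exI, rule weak_inverse_opposite)
    ultimately show ?thesis by blast
  qed
  then show ?thesis
    unfolding morita_equivalent_def by blast
qed

end
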